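(* Let $G$ be a 2-edge connected graph with $\delta(G) \ge 3$. If $G$ contains a path of odd length between any two distinct vertices, then its 3-arc graph $X(G)$ is Hamilton-connected.
   Context: All graphs are finite, undirected, without loops and without parallel edges. $\delta(G)$ denotes the minimum degree of $G$. The length of a path is its number of edges; a path has no repeated vertices. An arc of a graph $G$ is an ordered pair $uv$ of adjacent vertices $u,v$ (so $uv \neq vu$, and each edge gives two arcs); $A(G)$ is the set of all arcs of $G$. A 3-arc of $G$ is a 4-tuple $(v,u,x,y)$ of vertices, possibly with $v=y$, such that both $(v,u,x)$ and $(u,x,y)$ are paths of $G$ (i.e. $v\ne x$, $u\neq y$, and $\{v,u\},\{u,x\},\{x,y\}$ are edges of $G$). The 3-arc graph $X(G)$ of $G$ is the graph with vertex set $A(G)$ in which the vertices corresponding to arcs $uv$ and $xy$ are adjacent if and only if $(v,u,x,y)$ is a 3-arc of $G$. A graph is Hamilton-connected if any two distinct vertices are connected by a Hamilton path, i.e. a path containing every vertex of the graph. *)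

theory Defs
  imports Graph_Theory.Graph_Theory
begin

text \<open>
  A finite simple graph is a \<^term>\<open>pair_graph\<close>: a finite symmetric irreflexive
  relation \<^term>\<open>parcs G\<close> on \<^term>\<open>pverts G\<close>, so that an undirected edge
  corresponds to two opposite arcs and \<^term>\<open>parcs G\<close> is exactly the arc set $A(G)$.
  Degrees are out-degrees, and paths are the vertex paths \<^term>\<open>vpath\<close>.
\<close>

definition min_degree :: "'a pair_pre_digraph \<Rightarrow> nat" where
  "min_degree G = Min (out_degree (with_proj G) ` pverts G)"

definition uedges :: "'a pair_pre_digraph \<Rightarrow> 'a set set" where
  "uedges G = {{u, v} | u v. (u, v) \<in> parcs G}"

text \<open>Deleting an undirected edge removes both of its arcs.\<close>

definition del_uedges :: "'a pair_pre_digraph \<Rightarrow> 'a set set \<Rightarrow> 'a pair_pre_digraph" where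
  "del_uedges G F = \<lparr> pverts = pverts G, parcs = {(u, v) \<in> parcs G. {u, v} \<notin> F} \<rparr>"

text \<open>
  The usual convention: more than one vertex, and no set of fewer than $k$ edges
  disconnects the graph. The lower bound on the number of vertices excludes the
  empty and the one-vertex graph.
\<close>

definition edge_connected :: "nat \<Rightarrow> 'a pair_pre_digraph \<Rightarrow> bool" where
  "edge_connected k G \<longleftrightarrow> card (pverts G) > 1 \<and>
     (\<forall>F. F \<subseteq> uedges G \<and> finite F \<and> card F < k \<longrightarrow>
       Digraph_Component.connected (with_proj (del_uedges G F)))"

definition path_between :: "'a pair_pre_digraph \<Rightarrow> 'a \<Rightarrow> 'a vwalk \<Rightarrow> 'a \<Rightarrow> bool" where
  "path_between G u p v \<longleftrightarrow> vpath p (with_proj G) \<and> hd p = u \<and> last p = v"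

text \<open>The case $v = y$ is allowed, as only consecutive triples are required to be paths.\<close>

definition three_arc :: "'a pair_pre_digraph \<Rightarrow> 'a \<Rightarrow> 'a \<Rightarrow> 'a \<Rightarrow> 'a \<Rightarrow> bool" where
  "three_arc G v u x y \<longleftrightarrow> vpath [v, u, x] (with_proj G) \<and> vpath [u, x, y] (with_proj G)"

text \<open>The arcs $uv$ and $xy$ are joined via their tails $u$ and $x$.\<close>

definition three_arc_graph :: "'a pair_pre_digraph \<Rightarrow> ('a \<times> 'a) pair_pre_digraph" where
  "three_arc_graph G =
     \<lparr> pverts = parcs G,
       parcs = {((u, v), (x, y)) | u v x y.
         (u, v) \<in> parcs G \<and> (x, y) \<in> parcs G \<and> three_arc G v u x y} \<rparr>"

definition hamilton_connected :: "'a pair_pre_digraph \<Rightarrow> bool" where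
  "hamilton_connected G \<longleftrightarrow>
     (\<forall>s\<in>pverts G. \<forall>t\<in>pverts G. s \<noteq> t \<longrightarrow> (\<exists>p. path_between G s p t \<and> set p = pverts G))"

lemma pair_graph_three_arc_graph:
  assumes "pair_graph G"
  shows "pair_graph (three_arc_graph G)"
proof -
  interpret G: pair_graph G by (rule assms)
  let ?X = "three_arc_graph G"
  have sub: "parcs ?X \<subseteq> parcs G \<times> parcs G"
    by (auto simp: three_arc_graph_def)
  have fin: "finite (parcs ?X)"
    by (rule finite_subset[OF sub]) (simp add: G.pair_finite_arcs)
  have symm: "sym (parcs ?X)"
    by (rule symI) (auto simp: three_arc_graph_def three_arc_def vpath_def vwalk_def
        intro: G.arcs_symmetric)
  show ?thesis
  proof
    show "finite (pverts ?X)"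
      by (simp add: three_arc_graph_def G.pair_finite_arcs)
    show "finite (parcs ?X)" by (rule fin)
    show "symmetric (with_proj ?X)"
      using symm by (simp add: symmetric_def)
  qed (use sub in \<open>auto simp: three_arc_graph_def three_arc_def vpath_def\<close>)
qed

end

theory Submission
  imports Defs "HOL-Library.Multiset"
begin

text \<open>
  A Hamilton path of the 3-arc graph is a walk in \<open>G\<close> that visits every vertex \<open>u\<close> exactly
  \<open>deg u\<close> times, where the visits of \<open>u\<close> are labelled bijectively by the neighbours of \<open>u\<close> so
  that no label equals the preceding or the following vertex. Take every edge twice and alternately
  delete and add one copy along an odd path between the tails of the two given arcs (an odd cycle
  if the tails coincide); then all degrees are as required. At every vertex, fix for each
  label which two incident edges its visit uses. Visits on the two sides of an edge may be
  joined arbitrarily, so, as in Hierholzer's algorithm, closed walks sharing an edge can be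
  merged, and only connectedness matters. The local choices can be made connected except at an
  end of degree 3, where one edge may fall off; bridgelessness repairs this.
\<close>

subsection \<open>Alternating closed walks\<close>

text \<open>The two ends of the path act as the slots \<open>Inr False\<close> and
  \<open>Inr True\<close>, which \<open>swap_slot\<close> exchanges like the two sides of an edge.
  So the path is built as a closed walk and cut open at the joint between its ends. Each of the deg
  u visits of u uses two slots, so the multiplicities at u must add up to 2 deg u, less one for each
  end at u. The changes -1, +1, ... must therefore start and finish with -1, which forces odd
  length. The obstacle is an end u of degree 3 whose edge of multiplicity 1 leads to the head p of
  the end arc. With neighbours p, y, z the labels force one visit to enter and leave through the
  same neighbour, y or z, whose slots at u are then cut off from the other slots of u. That
  neighbour can be chosen freely from y and z, and the edge to it can still be reached from its
  other side. With distinct tails, two cuts that ruin both choices would intersect in a cut with a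
  single edge. If both ends lie at u and the two edges of multiplicity 1 lead to their heads, the
  third neighbour is lost without a choice, but then only one edge is affected, and it is no
  bridge.\<close>

definition flip :: "'n \<times> bool \<Rightarrow> 'n \<times> bool" where
  "flip d = (fst d, \<not> snd d)"

lemma fst_flip [simp]: "fst (flip d) = fst d"
  and flip_flip [simp]: "flip (flip d) = d"
  and flip_neq [simp]: "flip d \<noteq> d"
  by (auto simp: flip_def prod_eq_iff)

lemma fst_eq_iff_flip: "fst d = fst e \<longleftrightarrow> d = e \<or> d = flip e"
  by (auto simp: flip_def prod_eq_iff)

lemma obtain_longest:
  assumes "P x" and "\<And>ys. P ys \<Longrightarrow> length ys \<le> n"
  obtains xs where "P xs" "\<And>ys. P ys \<Longrightarrow> length ys \<le> length xs"
  using ex_has_greatest_nat[of P x length "Suc n"] assms by (metis le_imp_less_Suc)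

text \<open>Abstract form of walks through anonymous copies of edges: a type is one side of an edge,
  \<open>sw\<close> gives the opposite side, and any two slots of opposite types may be
  joined.\<close>

locale slot_types =
  fixes ty :: "'n \<times> bool \<Rightarrow> 't" and sw :: "'t \<Rightarrow> 't"
  assumes sw_sw [simp]: "sw (sw t) = t"
begin

lemma sw_eq_iff: "sw a = b \<longleftrightarrow> a = sw b"
  by auto

text \<open>A dart \<open>(n, b)\<close> is the node \<open>n\<close> entered through its slot \<open>b\<close> and left through the other one.\<close>

definition joins :: "'n \<times> bool \<Rightarrow> 'n \<times> bool \<Rightarrow> bool" where
  "joins d e \<longleftrightarrow> ty e = sw (ty (flip d))"

definition strand :: "('n \<times> bool) list \<Rightarrow> bool" where
  "strand xs \<longleftrightarrow> distinct (map fst xs) \<and> successively joins xs"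

definition closed_strand :: "('n \<times> bool) list \<Rightarrow> bool" where
  "closed_strand xs \<longleftrightarrow> xs \<noteq> [] \<and> strand xs \<and> joins (last xs) (hd xs)"

definition slots :: "'n set \<Rightarrow> 't \<Rightarrow> ('n \<times> bool) set" where
  "slots S \<tau> = {d. fst d \<in> S \<and> ty d = \<tau>}"

text \<open>Equal counts let all slots be paired off across \<open>sw\<close>. Excluding types fixed
  by \<open>sw\<close> ensures that an unpaired slot is a surplus of its type over the opposite
  one.\<close>

definition balanced :: "'n set \<Rightarrow> bool" where
  "balanced S \<longleftrightarrow> finite S \<and> (\<forall>d. fst d \<in> S \<longrightarrow> sw (ty d) \<noteq> ty d) \<and>
    (\<forall>\<tau>. card (slots S (sw \<tau>)) = card (slots S \<tau>))"

lemma finite_slots: "finite S \<Longrightarrow> finite (slots S \<tau>)"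
  by (rule finite_subset[of _ "S \<times> UNIV"]) (auto simp: slots_def)

lemma card_slots_insert:
  assumes "finite S" "fst x \<notin> S"
  shows "card (slots (insert (fst x) S) \<tau>) =
    card (slots S \<tau>) + of_bool (ty x = \<tau>) + of_bool (ty (flip x) = \<tau>)"
proof -
  have "slots (insert (fst x) S) \<tau> = slots S \<tau> \<union>
    ((if ty x = \<tau> then {x} else {}) \<union> (if ty (flip x) = \<tau> then {flip x} else {}))" (is "_ = _ \<union> ?D")
    unfolding slots_def by (force dest: iffD1[OF fst_eq_iff_flip] split: if_splits)
  moreover have "slots S \<tau> \<inter> ?D = {}"
    using assms by (auto simp: slots_def)
  moreover have "finite ?D" "card ?D = of_bool (ty x = \<tau>) + of_bool (ty (flip x) = \<tau>)"
    by simp_all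
  ultimately show ?thesis
    by (simp add: card_Un_disjoint finite_slots assms(1))
qed

text \<open>Every inner joint contributes one slot of a type and one of its swap, so only the two
  free slots at the ends disturb the balance. Their terms stand crosswise to avoid
  subtraction.\<close>

lemma card_slots_strand:
  assumes "strand xs" "xs \<noteq> []"
  shows "card (slots (fst ` set xs) \<tau>) + of_bool (ty (flip (last xs)) = sw \<tau>) + of_bool (ty (hd xs) = sw \<tau>)
    = card (slots (fst ` set xs) (sw \<tau>)) + of_bool (ty (flip (last xs)) = \<tau>) + of_bool (ty (hd xs) = \<tau>)"
  using assms(2,1)
proof (induction xs rule: list_nonempty_induct)
  case (single x)
  have [simp]: "slots {} t = {}" for t by (simp add: slots_def)
  show ?case using card_slots_insert[of "{}" x] by simp
next
  case (cons x xs)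
  have *: "strand xs" "fst x \<notin> fst ` set xs" "ty (hd xs) = sw (ty (flip x))"
    using cons by (cases xs; auto simp: strand_def joins_def)+
  have ins: "card (slots (fst ` set (x # xs)) t) =
      card (slots (fst ` set xs) t) + of_bool (ty x = t) + of_bool (ty (flip x) = t)" for t
    using card_slots_insert[of "fst ` set xs" x t] *(2) by simp
  have "(ty (hd xs) = \<tau>) = (ty (flip x) = sw \<tau>)" "(ty (hd xs) = sw \<tau>) = (ty (flip x) = \<tau>)"
    unfolding *(3) by (auto simp: sw_eq_iff)
  moreover have "last (x # xs) = last xs" "hd (x # xs) = x" using cons.hyps by simp_all
  ultimately show ?case
    using cons.IH[OF *(1)] unfolding ins by simp
qed

lemma card_slots_Diff:
  assumes "finite S" "T \<subseteq> S"
  shows "card (slots S \<tau>) = card (slots T \<tau>) + card (slots (S - T) \<tau>)"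
proof -
  have "slots S \<tau> = slots T \<tau> \<union> slots (S - T) \<tau>" using assms by (auto simp: slots_def)
  moreover have "slots T \<tau> \<inter> slots (S - T) \<tau> = {}" by (auto simp: slots_def)
  ultimately show ?thesis
    using assms by (simp add: card_Un_disjoint finite_slots finite_subset)
qed

lemma balanced_Diff_closed_strand:
  assumes "balanced S" "closed_strand xs" "fst ` set xs \<subseteq> S"
  shows "balanced (S - fst ` set xs)"
proof -
  have "card (slots (fst ` set xs) (sw \<tau>)) = card (slots (fst ` set xs) \<tau>)" for \<tau>
    using card_slots_strand[of xs \<tau>] assms(2) by (auto simp: closed_strand_def joins_def sw_eq_iff)
  then show ?thesis
    using assms(1,3) card_slots_Diff[of S "fst ` set xs"] unfolding balanced_def
    by (metis DiffD1 add_left_cancel finite_Diff)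
qed

lemma strand_append:
  assumes "strand xs" "strand ys" "fst ` set xs \<inter> fst ` set ys = {}"
    "xs \<noteq> [] \<Longrightarrow> ys \<noteq> [] \<Longrightarrow> joins (last xs) (hd ys)"
  shows "strand (xs @ ys)"
  using assms by (auto simp: strand_def successively_append_iff)

lemma card_strand: "strand xs \<Longrightarrow> card (fst ` set xs) = length xs"
  by (metis distinct_card length_map list.set_map strand_def)

lemma length_le_card_strand:
  assumes "finite S" "strand xs" "fst ` set xs \<subseteq> S"
  shows "length xs \<le> card S"
  using card_mono[OF assms(1,3)] card_strand[OF assms(2)] by simp

lemma closed_strand_exists:
  assumes bal: "balanced S" and x: "fst x \<in> S"
  obtains xs where "closed_strand xs" "hd xs = x" "fst ` set xs \<subseteq> S"
proof -
  let ?P = "\<lambda>xs. strand xs \<and> xs \<noteq> [] \<and> hd xs = x \<and> fst ` set xs \<subseteq> S"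
  have fin: "finite S" using bal by (simp add: balanced_def)
  have le: "length xs \<le> card S" if "?P xs" for xs
    using that by (intro length_le_card_strand fin) blast+
  have P: "?P [x]" using x by (simp add: strand_def)
  obtain xs where xs: "?P xs" and max: "\<And>ys. ?P ys \<Longrightarrow> length ys \<le> length xs"
    using obtain_longest[of ?P, OF P le] by blast
  have "joins (last xs) (hd xs)"
  proof (rule ccontr)
    let ?e = "ty (flip (last xs))" and ?T = "fst ` set xs"
    assume "\<not> joins (last xs) (hd xs)"
    moreover have "fst (flip (last xs)) \<in> S" using xs by auto
    then have "sw ?e \<noteq> ?e" using bal unfolding balanced_def by blast
    ultimately have "card (slots ?T ?e) > card (slots ?T (sw ?e))"
      using card_slots_strand[of xs ?e] xs by (auto simp: joins_def)
    moreover have "card (slots S ?e) = card (slots S (sw ?e))"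
      using bal by (simp add: balanced_def)
    moreover have "card (slots S t) = card (slots ?T t) + card (slots (S - ?T) t)" for t
      using card_slots_Diff[OF fin, of ?T] xs by blast
    ultimately have "card (slots (S - ?T) (sw ?e)) > 0" by (metis add_0_right gr0I not_add_less1)
    then obtain y where y: "fst y \<in> S - ?T" "ty y = sw ?e"
      by (auto simp: card_gt_0_iff slots_def)
    have "strand (xs @ [y])"
      by (rule strand_append) (use xs y in \<open>auto simp: strand_def joins_def\<close>)
    then have "?P (xs @ [y])" using xs y by simp
    from max[OF this] show False by simp
  qed
  with xs that show thesis by (auto simp: closed_strand_def)
qed

lemma closed_strand_rotate:
  assumes "closed_strand (xs @ ys)"
  shows "closed_strand (ys @ xs)"
  using assms
  by (cases "xs = []"; cases "ys = []") (auto simp: closed_strand_def strand_def successively_append_iff)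

lemma closed_strand_rev:
  assumes "closed_strand xs"
  shows "closed_strand (rev (map flip xs))"
proof -
  have "joins (flip y) (flip x) = joins x y" for x y
    by (auto simp: joins_def)
  then show ?thesis
    using assms by (auto simp: closed_strand_def strand_def successively_rev successively_map
        rev_map last_rev hd_rev last_map hd_map o_def distinct_map)
qed

text \<open>Rotation brings the node to the front; if the strand passes it in the other direction,
  it is reversed before.\<close>

lemma closed_strand_start:
  assumes "closed_strand xs" "fst d \<in> fst ` set xs"
  obtains ys where "closed_strand ys" "hd ys = d" "fst ` set ys = fst ` set xs"
proof -
  have *: "\<exists>ys. closed_strand ys \<and> hd ys = d \<and> fst ` set ys = fst ` set xs"
    if "closed_strand zs" "d \<in> set zs" "fst ` set zs = fst ` set xs" for zs
  proof -
    from that(2) obtain us vs where zs: "zs = us @ d # vs" by (meson split_list)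
    have "fst ` set ((d # vs) @ us) = fst ` set xs" using that(3) zs by auto
    then show ?thesis
      using that(1) closed_strand_rotate[of us "d # vs"] zs by (intro exI[of _ "(d # vs) @ us"]) auto
  qed
  have "d \<in> set xs \<or> d \<in> set (rev (map flip xs))"
    using assms(2) by (auto dest!: iffD1[OF fst_eq_iff_flip])
  then have "\<exists>ys. closed_strand ys \<and> hd ys = d \<and> fst ` set ys = fst ` set xs"
    using *[OF assms(1)] *[OF closed_strand_rev[OF assms(1)]] by (auto simp: image_image)
  then show thesis using that by blast
qed

text \<open>\<open>conn\<close> is connectedness, stated through sets of types closed under joints
  and under passing through a node. A longest closed strand absorbs every node that shares a type
  with it, so the types it meets form such a set.\<close>

theorem closed_strand_covering:
  assumes bal: "balanced S" and ne: "S \<noteq> {}"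
    and conn: "\<And>U. \<lbrakk>\<And>t. t \<in> U \<Longrightarrow> sw t \<in> U; \<And>d. \<lbrakk>fst d \<in> S; ty d \<in> U\<rbrakk> \<Longrightarrow> ty (flip d) \<in> U;
        \<exists>d. fst d \<in> S \<and> ty d \<in> U\<rbrakk> \<Longrightarrow> \<forall>n\<in>S. \<exists>d. fst d = n \<and> ty d \<in> U"
  obtains xs where "closed_strand xs" "fst ` set xs = S"
proof -
  let ?P = "\<lambda>xs. closed_strand xs \<and> fst ` set xs \<subseteq> S"
  have fin: "finite S" using bal by (simp add: balanced_def)
  from ne obtain n where "n \<in> S" by blast
  then obtain xs0 where P: "?P xs0" using closed_strand_exists[OF bal, of "(n, True)"] by force
  have le: "length xs \<le> card S" if "?P xs" for xs
    using that by (intro length_le_card_strand fin) (auto simp: closed_strand_def)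
  obtain xs where xs: "?P xs" and max: "\<And>ys. ?P ys \<Longrightarrow> length ys \<le> length xs"
    using obtain_longest[of ?P, OF P le] by blast
  let ?T = "fst ` set xs"
  define U where "U = {ty d |d. fst d \<in> ?T}"
  have len: "length ys = card (fst ` set ys)" if "closed_strand ys" for ys
    using that by (simp add: card_strand closed_strand_def)
  have out: "ty d \<notin> U" if d: "fst d \<in> S - ?T" for d
  proof
    assume "ty d \<in> U"
    then obtain c where c: "ty c = ty d" "fst c \<in> ?T" unfolding U_def by force
    obtain ys where ys: "closed_strand ys" "hd ys = c" "fst ` set ys = ?T"
      using closed_strand_start c(2) xs by blast
    obtain zs where zs: "closed_strand zs" "hd zs = d" "fst ` set zs \<subseteq> S - ?T"
      using closed_strand_exists[of "S - ?T" d] balanced_Diff_closed_strand[OF bal] d xs by metis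
    \<comment> \<open>Since \<open>c\<close> and \<open>d\<close> have equal types, the last dart of
      either closed strand may be followed by the head of the other.\<close>
    have "strand (ys @ zs)"
      by (rule strand_append) (use ys zs c in \<open>auto simp: closed_strand_def joins_def\<close>)
    then have cl: "closed_strand (ys @ zs)"
      using ys zs c by (auto simp: closed_strand_def joins_def)
    have "?P (ys @ zs)" using cl ys zs xs by (auto simp: image_Un)
    from max[OF this] have "length ys + length zs \<le> length xs" by simp
    moreover have "length ys = length xs" using len ys xs by metis
    ultimately show False using zs by (auto simp: closed_strand_def)
  qed
  have "\<forall>n\<in>S. \<exists>d. fst d = n \<and> ty d \<in> U"
  proof (rule conn)
    fix t assume "t \<in> U"
    then obtain d where d: "t = ty d" "fst d \<in> ?T" unfolding U_def by force
    then obtain ys where ys: "closed_strand ys" "hd ys = d" "fst ` set ys = ?T"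
      using closed_strand_start xs by blast
    then have "sw t = ty (flip (last ys))"
      using d by (auto simp: closed_strand_def joins_def)
    moreover have "fst (flip (last ys)) \<in> ?T"
      using ys by (metis closed_strand_def fst_flip image_eqI last_in_set)
    ultimately show "sw t \<in> U" unfolding U_def by blast
  next
    fix d assume "fst d \<in> S" "ty d \<in> U"
    then have "fst (flip d) \<in> ?T" using out[of d] unfolding fst_flip by blast
    then show "ty (flip d) \<in> U" unfolding U_def by blast
  next
    have "hd xs \<in> set xs" using xs by (auto simp: closed_strand_def)
    then show "\<exists>d. fst d \<in> S \<and> ty d \<in> U" using xs unfolding U_def by blast
  qed
  then have "?T = S" using out xs by fastforce
  with xs that show thesis by blast
qed

end

subsection \<open>Patterns at a vertex\<close>

text \<open>
  At a fixed vertex, the link \<open>(l, a, b)\<close> stands for the arc to the neighbour \<open>l\<close>, whose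
  predecessor and successor lie at \<open>a\<close> and \<open>b\<close>, in either order. A slot is a neighbour
  \<open>Inl n\<close>, or \<open>Inr False\<close> or \<open>Inr True\<close> for the two ends of the Hamilton path.
\<close>

type_synonym 'a link = "'a \<times> ('a + bool) \<times> ('a + bool)"

text \<open>For neighbour slots this is the 3-arc condition: the visit for the arc to
  \<open>l\<close> neither comes from \<open>l\<close> nor goes to \<open>l\<close>. An end slot
  belongs to the visit of its end arc.\<close>

fun fits :: "(bool \<Rightarrow> 'a) \<Rightarrow> 'a \<Rightarrow> 'a + bool \<Rightarrow> bool" where
  "fits e l (Inl p) \<longleftrightarrow> p \<noteq> l"
| "fits e l (Inr c) \<longleftrightarrow> e c = l"

definition link_slots :: "'a link list \<Rightarrow> ('a + bool) multiset" where
  "link_slots L = mset (map (fst \<circ> snd) L) + mset (map (snd \<circ> snd) L)"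

definition link_closed :: "'a link list \<Rightarrow> ('a + bool) set \<Rightarrow> bool" where
  "link_closed L U \<longleftrightarrow> (\<forall>(l, a, b)\<in>set L. a \<in> U \<longleftrightarrow> b \<in> U)"

text \<open>
  \<open>e\<close> gives the heads of the two end arcs, \<open>D\<close> the required number of slots of each kind.
  The last conjunct says that the slots in \<open>M\<close> are connected through the links, where the two
  ends count as joined to each other.
\<close>

definition link_pattern ::
    "(bool \<Rightarrow> 'a) \<Rightarrow> 'a set \<Rightarrow> ('a + bool) multiset \<Rightarrow> ('a + bool) set \<Rightarrow> 'a link list \<Rightarrow> bool" where
  "link_pattern e N D M L \<longleftrightarrow> distinct (map fst L) \<and> fst ` set L = N \<and> link_slots L = D \<and>
     (\<forall>(l, a, b)\<in>set L. fits e l a \<and> fits e l b) \<and>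
     (\<forall>U. link_closed L U \<longrightarrow> (Inr False \<in> U \<longleftrightarrow> Inr True \<in> U) \<longrightarrow> M \<subseteq> U \<or> M \<inter> U = {})"

text \<open>Consecutive links share a slot, so the chain is connected by construction. It uses the
  head of \<open>ps\<close> once and all others twice; the free slot \<open>X\<close> corrects these
  counts or is an end of the Hamilton path.\<close>

fun path_links :: "'a list \<Rightarrow> 'a list \<Rightarrow> ('a + bool) \<Rightarrow> 'a link list" where
  "path_links (l # ls) (p # q # ps) X = (l, Inl p, Inl q) # path_links ls (q # ps) X"
| "path_links [l] [p] X = [(l, Inl p, X)]"
| "path_links _ _ X = []"

fun avoids :: "'a list \<Rightarrow> 'a list \<Rightarrow> bool" where
  "avoids (l # ls) (p # q # ps) \<longleftrightarrow> l \<noteq> p \<and> l \<noteq> q \<and> avoids ls (q # ps)"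
| "avoids [l] [p] \<longleftrightarrow> l \<noteq> p"
| "avoids _ _ \<longleftrightarrow> False"

lemma link_slots_append [simp]: "link_slots (L @ L') = link_slots L + link_slots L'"
  by (simp add: link_slots_def)

lemma link_closed_Cons [simp]: "link_closed ((l, a, b) # L) U \<longleftrightarrow> (a \<in> U \<longleftrightarrow> b \<in> U) \<and> link_closed L U"
  by (simp add: link_closed_def)

lemma link_closed_append [simp]: "link_closed (L @ L') U \<longleftrightarrow> link_closed L U \<and> link_closed L' U"
  by (simp add: link_closed_def ball_Un)

lemma map_fst_path_links: "avoids ls ps \<Longrightarrow> map fst (path_links ls ps X) = ls"
  by (induction ls ps X rule: path_links.induct) auto

lemma link_slots_path_links:
  "avoids ls ps \<Longrightarrow> link_slots (path_links ls ps X) = image_mset Inl (mset ps) + image_mset Inl (mset (tl ps)) + {#X#}"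
  by (induction ls ps X rule: path_links.induct) (auto simp: link_slots_def)

lemma path_links_fits:
  assumes "avoids ls ps" "fits e (last ls) X"
  shows "\<forall>(l, a, b)\<in>set (path_links ls ps X). fits e l a \<and> fits e l b"
  using assms
proof (induction ls ps X rule: path_links.induct)
  case (1 l ls p q ps X)
  then have "ls \<noteq> []" by auto
  with 1 show ?case by auto
qed simp_all

lemma link_closed_path_links:
  assumes "avoids ls ps" "link_closed (path_links ls ps X) U" "y \<in> insert X (Inl ` set ps)"
  shows "y \<in> U \<longleftrightarrow> X \<in> U"
  using assms
proof (induction ls ps X arbitrary: y rule: path_links.induct)
  case (1 l ls p q ps X)
  have *: "link_closed (path_links ls (q # ps) X) U" "Inl p \<in> U \<longleftrightarrow> Inl q \<in> U" "avoids ls (q # ps)"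
    using 1(2,3) by simp_all
  have "y = Inl p \<or> y \<in> insert X (Inl ` set (q # ps))" using 1(4) by auto
  moreover have "Inl q \<in> insert X (Inl ` set (q # ps))" by simp
  ultimately show ?case using *(2) 1(1)[OF *(3,1)] by metis
qed auto

lemma path_pattern:
  assumes "avoids ls ps" "mset ls = mset ps" "distinct ps"
    and "fits e (last ls) X"
  shows "link_pattern e (set ps) (image_mset Inl (mset ps) + image_mset Inl (mset (tl ps)) + {#X#})
    (insert X (Inl ` set ps)) (path_links ls ps X)"
  unfolding link_pattern_def
proof (intro conjI allI impI)
  have "distinct ls" "set ls = set ps"
    using assms(2,3) mset_eq_imp_distinct_iff mset_eq_setD by blast+
  then show "distinct (map fst (path_links ls ps X))" "fst ` set (path_links ls ps X) = set ps"
    using map_fst_path_links[OF assms(1)] by (simp, metis list.set_map)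
  show "insert X (Inl ` set ps) \<subseteq> U \<or> insert X (Inl ` set ps) \<inter> U = {}"
    if "link_closed (path_links ls ps X) U" for U
    using link_closed_path_links[OF assms(1) that] by blast
qed (use assms link_slots_path_links path_links_fits[of ls ps e X] in auto)

text \<open>For coinciding tails: each chain runs from a neighbour of multiplicity 1 to one of the
  two ends, and the ends, counted as joined, connect the chains.\<close>

lemma two_path_pattern:
  assumes av: "avoids ls ps" "avoids ls' ps'"
    and qs: "mset (ls @ ls') = mset (ps @ ps')" "distinct (ps @ ps')"
    and e: "e c = last ls" "e (\<not> c) = last ls'"
  shows "link_pattern e (set (ps @ ps'))
    (image_mset Inl (mset (ps @ ps')) + image_mset Inl (mset (tl ps @ tl ps')) + {#Inr False, Inr True#})
    (insert (Inr False) (insert (Inr True) (Inl ` set (ps @ ps'))))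
    (path_links ls ps (Inr c) @ path_links ls' ps' (Inr (\<not> c)))" (is "link_pattern _ _ _ ?M ?L")
  unfolding link_pattern_def
proof (intro conjI allI impI)
  have "distinct (ls @ ls')" "set (ls @ ls') = set (ps @ ps')"
    using qs mset_eq_imp_distinct_iff mset_eq_setD by blast+
  moreover have "map fst ?L = ls @ ls'"
    by (simp add: map_fst_path_links av)
  ultimately show "distinct (map fst ?L)" "fst ` set ?L = set (ps @ ps')"
    by (simp, metis list.set_map)
  show "link_slots ?L = image_mset Inl (mset (ps @ ps')) + image_mset Inl (mset (tl ps @ tl ps')) +
      {#Inr False, Inr True#}"
    by (cases c) (simp_all add: link_slots_path_links av)
  show "?M \<subseteq> U \<or> ?M \<inter> U = {}" if "link_closed ?L U" "Inr False \<in> U \<longleftrightarrow> Inr True \<in> U" for U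
  proof -
    have "y \<in> U \<longleftrightarrow> Inr c \<in> U" if "y \<in> insert (Inr c) (Inl ` set ps)" for y
      using that link_closed_path_links[OF av(1)] \<open>link_closed ?L U\<close> by auto
    moreover have "y \<in> U \<longleftrightarrow> Inr (\<not> c) \<in> U" if "y \<in> insert (Inr (\<not> c)) (Inl ` set ps')" for y
      using that link_closed_path_links[OF av(2)] \<open>link_closed ?L U\<close> by auto
    moreover have "Inr c \<in> U \<longleftrightarrow> Inr False \<in> U" "Inr (\<not> c) \<in> U \<longleftrightarrow> Inr False \<in> U"
      using that(2) by (cases c; auto)+
    ultimately have "y \<in> U \<longleftrightarrow> Inr False \<in> U" if "y \<in> ?M" for y
      using that \<open>Inr False \<in> U \<longleftrightarrow> Inr True \<in> U\<close> by (auto simp: image_Un)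
    then show ?thesis by blast
  qed
  show "\<forall>(l, a, b)\<in>set ?L. fits e l a \<and> fits e l b"
    using path_links_fits[of ls ps e "Inr c"] path_links_fits[of ls' ps' e "Inr (\<not> c)"] av e
    unfolding set_append ball_Un by auto
qed

text \<open>The labels are the slots shifted by two places, so each link is labelled by the slot
  just after its own two. Only the last two labels, \<open>x\<close> and \<open>y\<close>, need a
  check.\<close>

lemma avoids_shift:
  assumes "distinct (a # b # rs)" "x \<notin> {last (butlast (a # b # rs)), last (b # rs)}" "y \<noteq> last (b # rs)"
  shows "avoids (rs @ [x, y]) (a # b # rs)"
  using assms by (induction rs arbitrary: a b) (auto split: if_splits)

text \<open>Shifting cyclically by two puts \<open>q0\<close> and \<open>q1\<close> on the last two
  links, so only \<open>q1\<close> must be compatible with \<open>X\<close>.\<close>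

lemma cyclic_pattern:
  assumes "distinct (q0 # q1 # q2 # rs)" "fits e q1 X"
  shows "\<exists>L. link_pattern e (set (q0 # q1 # q2 # rs))
    (image_mset Inl (mset (q0 # q1 # q2 # rs)) + image_mset Inl (mset (q1 # q2 # rs)) + {#X#})
    (insert X (Inl ` set (q0 # q1 # q2 # rs))) L"
proof -
  have "avoids ((q2 # rs) @ [q0, q1]) (q0 # q1 # q2 # rs)"
    by (rule avoids_shift) (use assms(1) in \<open>auto split: if_splits dest: in_set_butlastD last_in_set\<close>)
  from path_pattern[OF this, of e X] assms show ?thesis by fastforce
qed

text \<open>The last two labels of the cyclic shift are exchanged, so that the end slot falls to
  \<open>q0\<close>, the neighbour used once. With only three neighbours the label \<open>q1\<close>
  would land on the link between \<open>q1\<close> and \<open>q2\<close>.\<close>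

lemma start_pattern:
  assumes "distinct (q0 # q1 # q2 # q3 # rs)" "e c = q0"
  shows "\<exists>L. link_pattern e (set (q0 # q1 # q2 # q3 # rs))
    (image_mset Inl (mset (q0 # q1 # q2 # q3 # rs)) + image_mset Inl (mset (q1 # q2 # q3 # rs)) + {#Inr c#})
    (insert (Inr c) (Inl ` set (q0 # q1 # q2 # q3 # rs))) L"
proof -
  have "avoids ((q2 # q3 # rs) @ [q1, q0]) (q0 # q1 # q2 # q3 # rs)"
    by (rule avoids_shift) (use assms(1) in \<open>auto split: if_splits dest: in_set_butlastD last_in_set\<close>)
  from path_pattern[OF this, of e "Inr c"] assms show ?thesis by fastforce
qed

text \<open>The neighbours used once are \<open>q0\<close>, which is also an end label, and
  \<open>z\<close>. The other end label \<open>q1\<close> goes to the one-link chain from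
  \<open>z\<close> to its end.\<close>

lemma one_end_pattern:
  assumes "distinct (q0 # q1 # rs @ [z])" "e c = q0" "e (\<not> c) = q1"
  shows "\<exists>L. link_pattern e (set (q0 # q1 # rs @ [z]))
    (image_mset Inl (mset (q0 # q1 # rs @ [z])) + image_mset Inl (mset (q1 # rs)) + {#Inr False, Inr True#})
    (insert (Inr False) (insert (Inr True) (Inl ` set (q0 # q1 # rs @ [z])))) L"
proof -
  have "avoids (rs @ [z, q0]) (q0 # q1 # rs)"
    by (rule avoids_shift) (use assms in \<open>auto split: if_splits dest: in_set_butlastD last_in_set\<close>)
  from two_path_pattern[OF this, of "[q1]" "[z]" e c] assms show ?thesis by fastforce
qed

text \<open>The shift by two would spend \<open>q2\<close> on the first link, but \<open>q2\<close>
  must label the other end. So \<open>h\<close>, the next label in line, moves to the first link and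
  \<open>q0\<close> takes the second.\<close>

lemma no_end_pattern:
  assumes "distinct (q0 # q1 # q2 # rs @ [z])" "e c = q1" "e (\<not> c) = q2"
  shows "\<exists>L. link_pattern e (set (q0 # q1 # q2 # rs @ [z]))
    (image_mset Inl (mset (q0 # q1 # q2 # rs @ [z])) + image_mset Inl (mset (q1 # q2 # rs)) + {#Inr False, Inr True#})
    (insert (Inr False) (insert (Inr True) (Inl ` set (q0 # q1 # q2 # rs @ [z])))) L"
proof -
  obtain h t where ht: "rs @ [z] = h # t" by (cases "rs @ [z]") auto
  have "avoids (t @ [q1]) (q2 # rs)"
  proof (cases rs)
    case Nil
    then show ?thesis using assms(1) ht by auto
  next
    case (Cons r rs')
    have "avoids (rs' @ [z, q1]) (q2 # r # rs')"
      by (rule avoids_shift) (use assms(1) Cons in \<open>auto split: if_splits dest: in_set_butlastD last_in_set\<close>)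
    moreover have "t = rs' @ [z]" using ht Cons by simp
    ultimately show ?thesis using Cons by simp
  qed
  moreover have "h \<in> set (rs @ [z])" using ht by simp
  ultimately have "avoids (h # q0 # t @ [q1]) (q0 # q1 # q2 # rs)"
    using assms(1) by auto
  moreover have "mset (h # q0 # t @ [q1] @ [q2]) = mset (q0 # q1 # q2 # rs @ [z])"
    using arg_cong[OF ht, of mset] by simp
  ultimately show ?thesis
    using two_path_pattern[of "h # q0 # t @ [q1]" "q0 # q1 # q2 # rs" "[q2]" "[z]" e c] assms by fastforce
qed

text \<open>The link between \<open>v\<close> and \<open>r\<close> needs a label that is neither of
  them nor the other end label \<open>y\<close>; hence the fourth neighbour
  \<open>w\<close>.\<close>

lemma both_ends_pattern:
  assumes "distinct (v # r # y # w # ws)" "e c = v" "e (\<not> c) = y"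
  shows "\<exists>L. link_pattern e (set (v # r # y # w # ws))
    (image_mset Inl (mset (v # r # y # w # ws)) + image_mset Inl (mset (r # w # ws)) + {#Inr False, Inr True#})
    (insert (Inr False) (insert (Inr True) (Inl ` set (v # r # y # w # ws)))) L"
proof -
  have "avoids (ws @ [r, y]) (y # w # ws)"
    by (rule avoids_shift) (use assms(1) in \<open>auto split: if_splits dest: in_set_butlastD last_in_set\<close>)
  moreover have "avoids [w, v] [v, r]" using assms(1) by auto
  ultimately show ?thesis
    using two_path_pattern[of "[w, v]" "[v, r]" "ws @ [r, y]" "y # w # ws" e c] assms by fastforce
qed

text \<open>Neighbours in \<open>A\<close> and \<open>B\<close> are those along edges of multiplicity 1 and 3; all other
  edges have multiplicity 2.\<close>

definition vertex_pattern :: "(bool \<Rightarrow> 'a) \<Rightarrow> 'a set \<Rightarrow> 'a set \<Rightarrow> 'a set \<Rightarrow> bool set \<Rightarrow> ('a + bool) set \<Rightarrow> 'a link list \<Rightarrow> bool" where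
  "vertex_pattern e N A B C M L \<longleftrightarrow> link_pattern e N (link_slots L) M L \<and>
    (\<forall>n. count (link_slots L) (Inl n) = (if n \<notin> N then 0 else if n \<in> A then 1 else if n \<in> B then 3 else 2)) \<and>
    (\<forall>c. count (link_slots L) (Inr c) = of_bool (c \<in> C))"

lemma count_Inl_image [simp]: "count (image_mset Inl M) (Inl x) = count M x"
  "count (image_mset Inl M) (Inr c) = 0"
  by (induction M) auto

lemma link_patternD: "link_pattern e N D M L \<Longrightarrow> link_slots L = D"
  by (simp add: link_pattern_def)

lemma link_pattern_mono: "link_pattern e N D M L \<Longrightarrow> M' \<subseteq> M \<Longrightarrow> link_pattern e N D M' L"
  unfolding link_pattern_def by blast

section \<open>Patterns for every position of the edges of multiplicity 1 and 3\<close>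

lemma vertex_patternI:
  assumes "link_pattern e N' D M L" "N' = N" "M' \<subseteq> M"
    "\<And>n. count D (Inl n) = (if n \<notin> N then 0 else if n \<in> A then 1 else if n \<in> B then 3 else 2)"
    "\<And>c. count D (Inr c) = of_bool (c \<in> C)"
  shows "vertex_pattern e N A B C M' L"
  using assms link_pattern_mono[OF assms(1,3)] by (auto simp: vertex_pattern_def link_patternD)

lemma count_mset_distinct: "distinct xs \<Longrightarrow> count (mset xs) x = of_bool (x \<in> set xs)"
  by (simp add: distinct_count_atmost_1)

lemma distinct_list_extend:
  assumes "finite N" "set xs \<subseteq> N" "distinct xs"
  obtains rs where "distinct (xs @ rs)" "set (xs @ rs) = N"
proof -
  obtain rs where "set rs = N - set xs" "distinct rs"
    using finite_distinct_list[of "N - set xs"] assms(1) by auto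
  then show thesis using that[of rs] assms by auto
qed

lemma vertex_pattern_plain:
  assumes "finite N" "card N \<ge> 3"
  shows "\<exists>L. vertex_pattern e N {} {} {} (Inl ` N) L"
proof -
  obtain qs where qs: "distinct qs" "set qs = N"
    using distinct_list_extend[OF assms(1), of "[]"] by auto
  then have "length qs \<ge> 3" using assms(2) distinct_card by fastforce
  then obtain q0 q1 q2 rs where q: "qs = q0 # q1 # q2 # rs"
    by (auto simp: numeral_3_eq_3 Suc_le_length_iff)
  \<comment> \<open>\<open>X = Inl q0\<close> supplies the second copy that the first neighbour
    lacks.\<close>
  obtain L where "link_pattern e (set (q0 # q1 # q2 # rs))
    (image_mset Inl (mset (q0 # q1 # q2 # rs)) + image_mset Inl (mset (q1 # q2 # rs)) + {#Inl q0#})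
    (insert (Inl q0) (Inl ` set (q0 # q1 # q2 # rs))) L"
    using cyclic_pattern[of q0 q1 q2 rs e "Inl q0"] qs q by auto
  then have "vertex_pattern e N {} {} {} (Inl ` N) L"
    by (rule vertex_patternI) (use qs q in \<open>auto simp: count_mset_distinct\<close>)
  then show ?thesis by blast
qed

lemma vertex_pattern_inner:
  assumes "finite N" "card N \<ge> 3" "a \<in> N" "b \<in> N" "a \<noteq> b"
  shows "\<exists>L. vertex_pattern e N {a} {b} {} (Inl ` N) L"
proof -
  obtain rs where qs: "distinct ([a, b] @ rs)" "set ([a, b] @ rs) = N"
    using distinct_list_extend[OF assms(1), of "[a, b]"] assms by auto
  then have "length ([a, b] @ rs) \<ge> 3" using assms(2) distinct_card by fastforce
  then obtain r rs' where q: "rs = r # rs'"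
    by (cases rs) auto
  \<comment> \<open>The third copy of \<open>b\<close> is the slot \<open>X\<close>, whose link is
    labelled by the second entry; so that entry must not be \<open>b\<close>.\<close>
  have q: "distinct (a # r # b # rs')" "set (a # r # b # rs') = N" using qs q by auto
  obtain L where "link_pattern e (set (a # r # b # rs'))
    (image_mset Inl (mset (a # r # b # rs')) + image_mset Inl (mset (r # b # rs')) + {#Inl b#})
    (insert (Inl b) (Inl ` set (a # r # b # rs'))) L"
    using cyclic_pattern[OF q(1), of e "Inl b"] q by auto
  then have "vertex_pattern e N {a} {b} {} (Inl ` N) L"
    by (rule vertex_patternI) (use q in \<open>auto simp: count_mset_distinct\<close>)
  then show ?thesis by blast
qed

lemma vertex_pattern_end:
  assumes "finite N" "card N \<ge> 3" "p \<in> N" "e c \<in> N" "p \<noteq> e c \<or> card N \<ge> 4"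
  shows "\<exists>L. vertex_pattern e N {p} {} {c} (insert (Inr c) (Inl ` N)) L"
proof (cases "p = e c")
  case False
  obtain rs where qs: "distinct ([p, e c] @ rs)" "set ([p, e c] @ rs) = N"
    using distinct_list_extend[OF assms(1), of "[p, e c]"] assms False by auto
  then have "length ([p, e c] @ rs) \<ge> 3" using assms(2) distinct_card by fastforce
  then obtain r rs' where q: "rs = r # rs'"
    by (cases rs) auto
  \<comment> \<open>The second entry labels the link to \<open>X\<close>, here the end slot, so
    \<open>e c\<close> goes there.\<close>
  then have q: "distinct (p # e c # r # rs')" "set (p # e c # r # rs') = N" using qs by auto
  obtain L where "link_pattern e (set (p # e c # r # rs'))
    (image_mset Inl (mset (p # e c # r # rs')) + image_mset Inl (mset (e c # r # rs')) + {#Inr c#})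
    (insert (Inr c) (Inl ` set (p # e c # r # rs'))) L"
    using cyclic_pattern[OF q(1), of e "Inr c"] q by auto
  then have "vertex_pattern e N {p} {} {c} (insert (Inr c) (Inl ` N)) L"
    by (rule vertex_patternI) (use q in \<open>auto simp: count_mset_distinct\<close>)
  then show ?thesis by blast
next
  case True
  obtain rs where qs: "distinct ([p] @ rs)" "set ([p] @ rs) = N"
    using distinct_list_extend[OF assms(1), of "[p]"] assms by auto
  then have "length ([p] @ rs) \<ge> 4" using assms(5) True distinct_card by fastforce
  then obtain q1 q2 q3 rs' where q: "rs = q1 # q2 # q3 # rs'"
    by (auto simp: eval_nat_numeral Suc_le_length_iff)
  then have q: "distinct (p # q1 # q2 # q3 # rs')" "set (p # q1 # q2 # q3 # rs') = N" using qs by auto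
  obtain L where "link_pattern e (set (p # q1 # q2 # q3 # rs'))
    (image_mset Inl (mset (p # q1 # q2 # q3 # rs')) + image_mset Inl (mset (q1 # q2 # q3 # rs')) + {#Inr c#})
    (insert (Inr c) (Inl ` set (p # q1 # q2 # q3 # rs'))) L"
    using start_pattern[OF q(1), of e c] True by auto
  then have "vertex_pattern e N {p} {} {c} (insert (Inr c) (Inl ` N)) L"
    by (rule vertex_patternI) (use q in \<open>auto simp: count_mset_distinct\<close>)
  then show ?thesis by blast
qed

text \<open>Once the link of \<open>e c\<close> uses the third neighbour \<open>y\<close>, the rest
  is forced: both copies of \<open>z\<close> go to the visit labelled \<open>y\<close>, which
  isolates \<open>z\<close>. Either neighbour other than \<open>e c\<close> can take the part of
  \<open>z\<close>.\<close>

lemma vertex_pattern_bad_end: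
  assumes "card N = 3" "e c \<in> N" "z \<in> N" "z \<noteq> e c"
  shows "\<exists>L. vertex_pattern e N {e c} {} {c} (insert (Inr c) (Inl ` (N - {z}))) L"
proof -
  have "finite N" using assms(1) card.infinite by fastforce
  then obtain rs where qs: "distinct ([e c, z] @ rs)" "set ([e c, z] @ rs) = N"
    using distinct_list_extend[of N "[e c, z]"] assms by auto
  moreover have "length ([e c, z] @ rs) = 3" using qs assms(1) distinct_card by fastforce
  ultimately obtain y where y: "distinct [e c, z, y]" "N = {e c, z, y}"
    by (auto simp: length_Suc_conv numeral_3_eq_3)
  let ?L = "[(z, Inl (e c), Inl y), (y, Inl z, Inl z), (e c, Inl y, Inr c)]"
  have N: "N - {z} = {e c, y}" using y by auto
  have "vertex_pattern e N {e c} {} {c} (insert (Inr c) (Inl ` (N - {z}))) ?L"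
    unfolding vertex_pattern_def link_pattern_def N using y
    by (auto simp: link_slots_def link_closed_def)
  then show ?thesis by blast
qed

text \<open>The cases are how many of the neighbours of multiplicity 1 are heads of end arcs. Only
  two such heads and degree 3 really disconnect a neighbour; in the other cases the chains connect
  all slots.\<close>

lemma vertex_pattern_both:
  assumes "finite N" "card N \<ge> 3" "p \<in> N" "p' \<in> N" "p \<noteq> p'" "e False \<in> N" "e True \<in> N" "e False \<noteq> e True"
  shows "\<exists>z L. vertex_pattern e N {p, p'} {} UNIV (Inl ` (N - {z})) L"
proof -
  consider (one) c z where "{p, p'} = {e c, z}" "z \<noteq> e (\<not> c)" "z \<noteq> e c"
    | (no) "{p, p'} \<inter> {e False, e True} = {}" | (both) "{p, p'} = {e False, e True}"
  proof -
    have "(\<exists>c z. {p, p'} = {e c, z} \<and> z \<noteq> e (\<not> c) \<and> z \<noteq> e c) \<or>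
      {p, p'} \<inter> {e False, e True} = {} \<or> {p, p'} = {e False, e True}"
      unfolding ex_bool_eq using assms(5,8) by auto
    then show thesis using that by blast
  qed
  then show ?thesis
  proof cases
    case one
    have ne: "e c \<noteq> e (\<not> c)" "e c \<in> N" "e (\<not> c) \<in> N" using assms by (cases c; auto)+
    have "z \<in> {p, p'}" unfolding one(1) by simp
    then have "z \<in> N" using assms(3,4) by auto
    obtain rs where qs: "distinct ([e c, e (\<not> c), z] @ rs)" "set ([e c, e (\<not> c), z] @ rs) = N"
      using distinct_list_extend[OF assms(1), of "[e c, e (\<not> c), z]"] one(2,3) ne \<open>z \<in> N\<close> by auto
    then have q: "distinct (e c # e (\<not> c) # rs @ [z])" "set (e c # e (\<not> c) # rs @ [z]) = N" by auto
    obtain L where "link_pattern e (set (e c # e (\<not> c) # rs @ [z]))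
      (image_mset Inl (mset (e c # e (\<not> c) # rs @ [z])) + image_mset Inl (mset (e (\<not> c) # rs)) +
        {#Inr False, Inr True#})
      (insert (Inr False) (insert (Inr True) (Inl ` set (e c # e (\<not> c) # rs @ [z])))) L"
      using one_end_pattern[OF q(1), of e c] by auto
    then have "vertex_pattern e N {e c, z} {} UNIV (Inl ` (N - {z})) L"
      by (rule vertex_patternI) (use q in \<open>auto simp: count_mset_distinct\<close>)
    then show ?thesis unfolding one(1) by blast
  next
    case no
    obtain rs where qs: "distinct ([p, e False, e True, p'] @ rs)" "set ([p, e False, e True, p'] @ rs) = N"
      by (rule distinct_list_extend[OF assms(1), of "[p, e False, e True, p']"]) (use no assms in auto)
    then have q: "distinct (p # e False # e True # rs @ [p'])" "set (p # e False # e True # rs @ [p']) = N"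
      by auto
    obtain L where "link_pattern e (set (p # e False # e True # rs @ [p']))
      (image_mset Inl (mset (p # e False # e True # rs @ [p'])) + image_mset Inl (mset (e False # e True # rs)) +
        {#Inr False, Inr True#})
      (insert (Inr False) (insert (Inr True) (Inl ` set (p # e False # e True # rs @ [p'])))) L"
      using no_end_pattern[OF q(1), of e False] by auto
    then have "vertex_pattern e N {p, p'} {} UNIV (Inl ` (N - {p})) L"
      by (rule vertex_patternI) (use q in \<open>auto simp: count_mset_distinct\<close>)
    then show ?thesis by blast
  next
    case both
    obtain rs where qs: "distinct ([e False, e True] @ rs)" "set ([e False, e True] @ rs) = N"
      by (rule distinct_list_extend[OF assms(1), of "[e False, e True]"]) (use assms in auto)
    then have len: "length ([e False, e True] @ rs) \<ge> 3" using assms(2) distinct_card by fastforce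
    then obtain r rs' where r: "rs = r # rs'" by (cases rs) auto
    show ?thesis
    proof (cases rs')
      case Nil
      \<comment> \<open>Forced: the visit labelled \<open>r\<close> can only use the two heads, so
        the slots to \<open>r\<close> are linked to the end slots alone.\<close>
      let ?L = "[(r, Inl (e False), Inl (e True)), (e False, Inl r, Inr False), (e True, Inl r, Inr True)]"
      have N: "N - {r} = {e False, e True}" "N = {e False, e True, r}" using qs r Nil by auto
      have "vertex_pattern e N {e False, e True} {} UNIV (Inl ` (N - {r})) ?L"
        unfolding vertex_pattern_def link_pattern_def N(1) using qs r Nil unfolding N(2)
        by (auto simp: link_slots_def link_closed_def)
      then show ?thesis unfolding both by blast
    next
      case (Cons w ws)
      then have q: "distinct (e False # r # e True # w # ws)" "set (e False # r # e True # w # ws) = N"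
        using qs r by auto
      obtain L where "link_pattern e (set (e False # r # e True # w # ws))
        (image_mset Inl (mset (e False # r # e True # w # ws)) + image_mset Inl (mset (r # w # ws)) +
          {#Inr False, Inr True#})
        (insert (Inr False) (insert (Inr True) (Inl ` set (e False # r # e True # w # ws)))) L"
        using both_ends_pattern[OF q(1), of e False] by auto
      then have "vertex_pattern e N {e False, e True} {} UNIV (Inl ` (N - {r})) L"
        by (rule vertex_patternI) (use q in \<open>auto simp: count_mset_distinct\<close>)
      then show ?thesis unfolding both by blast
    qed
  qed
qed

subsection \<open>Odd cycles and alternating paths\<close>

lemma rtrancl_imp_distinct_path:
  assumes "(a, b) \<in> R\<^sup>*"
  shows "\<exists>p. p \<noteq> [] \<and> distinct p \<and> successively (\<lambda>x y. (x, y) \<in> R) p \<and> hd p = a \<and> last p = b"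
  using assms
proof (induction rule: converse_rtrancl_induct)
  case base
  then show ?case by (intro exI[of _ "[b]"]) auto
next
  case (step a a')
  then obtain p where p: "p \<noteq> []" "distinct p" "successively (\<lambda>x y. (x, y) \<in> R) p" "hd p = a'" "last p = b"
    by blast
  show ?case
  proof (cases "a \<in> set p")
    case True
    then obtain us vs where "p = us @ a # vs" by (meson split_list)
    with p show ?thesis by (intro exI[of _ "a # vs"]) (auto simp: successively_append_iff)
  next
    case False
    with p step(1) show ?thesis by (intro exI[of _ "a # p"]) (auto simp: successively_Cons)
  qed
qed

lemma set_vwalk_arcs_subset_iff: "set (vwalk_arcs p) \<subseteq> R \<longleftrightarrow> successively (\<lambda>x y. (x, y) \<in> R) p"
  by (induction p rule: vwalk_arcs.induct) auto

lemma path_betweenE: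
  assumes "path_between G u p v"
  shows "p \<noteq> []" "distinct p" "successively (\<lambda>x y. (x, y) \<in> parcs G) p" "hd p = u" "last p = v"
  using assms by (auto simp: path_between_def vpath_def vwalk_def set_vwalk_arcs_subset_iff)

locale bridgeless_graph = pair_graph G for G :: "'a pair_pre_digraph" +
  assumes edge_conn: "edge_connected 2 G"
begin

abbreviation E :: "'a rel" where "E \<equiv> parcs G"

abbreviation walk :: "'a list \<Rightarrow> bool" where "walk \<equiv> successively (\<lambda>x y. (x, y) \<in> E)"

lemma reachable_avoiding_edge:
  assumes "u \<in> pverts G" "v \<in> pverts G"
  shows "(u, v) \<in> {(a, b) \<in> E. {a, b} \<noteq> e}\<^sup>*"
proof -
  let ?R = "{(a, b) \<in> E. {a, b} \<noteq> e}"
  \<comment> \<open>The intersection covers the case that \<open>e\<close> is not an edge.\<close>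
  have "card ({e} \<inter> uedges G) \<le> card {e}" by (rule card_mono) auto
  then have "Digraph_Component.connected (with_proj (del_uedges G ({e} \<inter> uedges G)))"
    using edge_conn unfolding edge_connected_def by simp
  then have "(u, v) \<in> rtrancl_on (pverts G) ((parcs (del_uedges G ({e} \<inter> uedges G)))\<^sup>s)"
    using assms by (auto simp: connected_conv del_uedges_def)
  moreover have "(parcs (del_uedges G ({e} \<inter> uedges G)))\<^sup>s = ?R"
    using arcs_symmetric by (auto simp: del_uedges_def symcl_def uedges_def insert_commute)
  ultimately show ?thesis using rtrancl_on_rtranclI by metis
qed

lemma crossing_arc:
  assumes "T \<noteq> {}" "T \<subset> pverts G"
  obtains a b where "(a, b) \<in> E" "a \<in> T" "b \<notin> T" "{a, b} \<noteq> e"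
proof -
  obtain u v where uv: "u \<in> T" "v \<in> pverts G" "v \<notin> T" using assms by blast
  have "(u, v) \<in> {(a, b) \<in> E. {a, b} \<noteq> e}\<^sup>*"
    using reachable_avoiding_edge uv assms by blast
  then have "v \<in> T \<or> (\<exists>a b. (a, b) \<in> E \<and> a \<in> T \<and> b \<notin> T \<and> {a, b} \<noteq> e)"
    by (induction rule: rtrancl_induct) (use uv in auto)
  then show thesis using uv that by blast
qed

section \<open>Odd cycles through a prescribed vertex\<close>

definition cycle_list :: "'a list \<Rightarrow> bool" where
  "cycle_list c \<longleftrightarrow> distinct c \<and> length c \<ge> 3 \<and> walk c \<and> (last c, hd c) \<in> E"

lemma cycle_through:
  assumes "(u, a) \<in> E"
  obtains c where "cycle_list c" "hd c = u"
proof -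
  have "(u, a) \<in> {(x, y) \<in> E. {x, y} \<noteq> {u, a}}\<^sup>*"
    using reachable_avoiding_edge assms in_arcsD1 in_arcsD2 by blast
  from rtrancl_imp_distinct_path[OF this] obtain p where
    p: "p \<noteq> []" "distinct p" "successively (\<lambda>x y. (x, y) \<in> {(x, y) \<in> E. {x, y} \<noteq> {u, a}}) p" "hd p = u" "last p = a"
    by blast
  have ne: "u \<noteq> a" using assms no_loops' by blast
  have "length p \<noteq> 1" using p ne by (auto simp: length_Suc_conv)
  moreover have "length p \<noteq> 2" using p by (auto simp: length_Suc_conv numeral_2_eq_2)
  moreover have "length p \<noteq> 0" using p by simp
  ultimately have "length p \<ge> 3" by linarith
  moreover have "walk p" using p(3) by (rule successively_mono) auto
  ultimately show thesis using that[of p] p assms arcs_symmetric by (auto simp: cycle_list_def)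
qed

lemma walk_rev: "walk (rev p) \<longleftrightarrow> walk p"
proof -
  have "(\<lambda>x y. (y, x) \<in> E) = (\<lambda>x y. (x, y) \<in> E)" using arcs_symmetric by blast
  then show ?thesis by (simp only: successively_rev)
qed

text \<open>A walk between two vertices of an even cycle is \<open>twisted\<close> if its parity contradicts
  the proper 2-colouring \<open>f\<close> of the cycle.\<close>

definition twisted :: "'a set \<Rightarrow> ('a \<Rightarrow> bool) \<Rightarrow> 'a list \<Rightarrow> bool" where
  "twisted C f q \<longleftrightarrow> q \<noteq> [] \<and> distinct q \<and> walk q \<and> hd q \<in> C \<and> last q \<in> C \<and>
     ((f (hd q) \<longleftrightarrow> f (last q)) \<longleftrightarrow> even (length q))"

lemma twisted_rev: "twisted C f (rev q) \<longleftrightarrow> twisted C f q"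
  unfolding twisted_def walk_rev by (auto simp: hd_rev last_rev)

text \<open>Cutting a twisted path at an inner vertex of \<open>C\<close> adds up the parity defects
  of the two pieces, so exactly one piece is again twisted; a shortest such piece is an ear.\<close>

lemma twisted_ear:
  assumes "twisted C f q"
  obtains h m l where "twisted C f (h # m @ [l])" "set m \<inter> C = {}"
proof -
  have "\<exists>h m l. twisted C f (h # m @ [l]) \<and> set m \<inter> C = {}"
    using assms
  proof (induction q rule: length_induct)
    case (1 q)
    have "length q \<noteq> 1" using 1(2) by (auto simp: twisted_def length_Suc_conv)
    moreover obtain h r where q0: "q = h # r" using 1(2) by (cases q) (auto simp: twisted_def)
    ultimately obtain m l where q: "q = h # m @ [l]" by (cases r rule: rev_cases) auto
    show ?case
    proof (cases "set m \<inter> C = {}")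
      case True
      then show ?thesis using 1(2) q by blast
    next
      case False
      then obtain x where "x \<in> set m" "x \<in> C" by blast
      then obtain m1 m2 where m: "m = m1 @ x # m2" by (meson split_list)
      let ?q1 = "h # m1 @ [x]" and ?q2 = "x # m2 @ [l]"
      have "q = ?q1 @ (m2 @ [l])" "q = (h # m1) @ ?q2" using q m by simp_all
      then have w: "walk ?q1" "walk ?q2"
        using 1(2) unfolding twisted_def by (metis successively_append_iff)+
      have d: "distinct ?q1" "distinct ?q2" using 1(2) unfolding q m twisted_def by auto
      have "(f h \<longleftrightarrow> f l) \<longleftrightarrow> (even (length m1) \<longleftrightarrow> odd (length m2))" "h \<in> C" "l \<in> C"
        using 1(2) unfolding q m twisted_def by auto
      then have "twisted C f ?q1 \<or> twisted C f ?q2"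
        using \<open>x \<in> C\<close> w d unfolding twisted_def by auto
      moreover have "length ?q1 < length q" "length ?q2 < length q" using q m by auto
      ultimately show ?thesis using 1(1) by blast
    qed
  qed
  then show thesis using that by blast
qed

text \<open>In an even cycle, an odd path between two vertices of equal colour is twisted and so
  contains a twisted ear. Exchanging the stretch between the feet of the ear for the ear changes the
  parity.\<close>

lemma odd_cycle_through:
  assumes c: "cycle_list c"
    and odd_path: "\<And>u v. \<lbrakk>u \<in> pverts G; v \<in> pverts G; u \<noteq> v\<rbrakk> \<Longrightarrow> \<exists>p. path_between G u p v \<and> odd (vwalk_length p)"
  obtains c' where "cycle_list c'" "hd c' = hd c" "odd (length c')"
proof (cases "odd (length c)")
  case True
  then show thesis using c that by blast
next
  case False
  define f where "f x \<longleftrightarrow> (\<exists>i<length c. even i \<and> c ! i = x)" for x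
  have f: "f (c ! i) \<longleftrightarrow> even i" if "i < length c" for i
    using c that by (auto simp: f_def cycle_list_def nth_eq_iff_index_eq)
  have "length c \<noteq> 3" using False by auto
  then have len: "length c \<ge> 4" using c by (auto simp: cycle_list_def)
  have verts: "c ! i \<in> pverts G" if "i < length c" for i
  proof (cases "Suc i < length c")
    case True
    then have "(c ! i, c ! Suc i) \<in> E" using c by (simp add: cycle_list_def successively_conv_nth)
    then show ?thesis by (rule in_arcsD1)
  next
    case False
    then have "i = length c - 1" using that by simp
    moreover have "c \<noteq> []" using that by auto
    ultimately have "c ! i = last c" by (simp add: last_conv_nth)
    then show ?thesis using c in_arcsD1 by (auto simp: cycle_list_def)
  qed
  have pos: "distinct c" "0 < length c" "2 < length c" using c len unfolding cycle_list_def by (blast, linarith, linarith)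
  then have "c ! 0 \<noteq> c ! 2" using nth_eq_iff_index_eq[of c 0 2] by linarith
  moreover have "c ! 0 \<in> pverts G" "c ! 2 \<in> pverts G" using verts pos by blast+
  ultimately obtain p where p: "path_between G (c ! 0) p (c ! 2)" "odd (vwalk_length p)"
    using odd_path by blast
  note pb = path_betweenE[OF p(1)]
  have "even (length p)" using p(2) pb(1) by simp
  moreover have "f (c ! 0)" "f (c ! 2)" using f pos by simp_all
  moreover have "c ! 0 \<in> set c" "c ! 2 \<in> set c" using pos nth_mem by blast+
  ultimately have "twisted (set c) f p" using pb by (simp add: twisted_def)
  then obtain h m l where ear: "twisted (set c) f (h # m @ [l])" "set m \<inter> set c = {}"
    by (rule twisted_ear)
  have ear': "twisted (set c) f (l # rev m @ [h])"
    using ear(1) twisted_rev[of "set c" f "h # m @ [l]"] by simp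
  have main: "\<exists>c'. cycle_list c' \<and> hd c' = hd c \<and> odd (length c')" if tw: "twisted (set c) f (c ! i # m @ [c ! j])" and m: "set m \<inter> set c = {}"
    and ij: "i < j" "j < length c" for i j m
  proof -
    \<comment> \<open>Only positions strictly between \<open>i\<close> and \<open>j\<close> are
      replaced, so the head of \<open>c\<close> stays on the cycle.\<close>
    let ?c = "take (Suc i) c @ m @ drop j c"
    have ck: "c = take (Suc i) c @ drop (Suc i) c" "c = take j c @ drop j c" by simp_all
    have w: "walk (take (Suc i) c)" "walk (drop j c)"
      using c ck by (metis cycle_list_def successively_append_iff)+
    have ends: "last (take (Suc i) c) = c ! i" "hd (drop j c) = c ! j" "last (drop j c) = last c"
        "hd (take (Suc i) c) = hd c" "take (Suc i) c \<noteq> []" "drop j c \<noteq> []"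
      using ij by (simp add: take_Suc_conv_app_nth, simp add: hd_drop_conv_nth, simp, simp, auto)
    have "walk (c ! i # m @ [c ! j])" using tw by (simp add: twisted_def)
    then have "walk ?c"
      using w ends by (auto simp: successively_append_iff successively_Cons hd_append)
    moreover have "distinct ?c"
    proof -
      have "set (take (Suc i) c) \<inter> set (drop j c) = {}"
        using c ij set_take_disj_set_drop_if_distinct[of c "Suc i" j] by (simp add: cycle_list_def)
      moreover have "set (take (Suc i) c) \<subseteq> set c" "set (drop j c) \<subseteq> set c"
        by (rule set_take_subset, rule set_drop_subset)
      ultimately show ?thesis
        using m tw c by (auto simp: twisted_def cycle_list_def)
    qed
    moreover have odd: "odd (length ?c)"
      using tw f[of i] f[of j] ij False by (auto simp: twisted_def)
    moreover have "length ?c \<ge> 3"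
    proof -
      have "length ?c \<ge> 2" using ij by simp
      moreover have "length ?c \<noteq> 2" using odd even_numeral by metis
      ultimately show ?thesis by linarith
    qed
    moreover have "last ?c = last c" "hd ?c = hd c" using ends by auto
    ultimately have "cycle_list ?c \<and> hd ?c = hd c \<and> odd (length ?c)"
      using c unfolding cycle_list_def by simp
    then show ?thesis by blast
  qed
  have "h \<in> set c" "l \<in> set c" "h \<noteq> l" using ear(1) by (auto simp: twisted_def)
  then obtain i j where ij: "i < length c" "j < length c" "h = c ! i" "l = c ! j" "i \<noteq> j"
    by (auto simp: in_set_conv_nth)
  have "\<exists>c'. cycle_list c' \<and> hd c' = hd c \<and> odd (length c')"
  proof (cases "i < j")
    case True
    then show ?thesis using main[of i m j] ear ij by simp
  next
    case False
    then show ?thesis using main[of j "rev m" i] ear' ear(2) ij by simp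
  qed
  then show thesis using that by blast
qed

text \<open>Changing the multiplicities of the edges of an odd path or cycle alternately
  by \<open>-1\<close> (the sets \<open>A\<close>) and \<open>+1\<close> (the sets \<open>B\<close>) lowers the degree only at its ends.\<close>

definition alternating :: "'a \<Rightarrow> 'a \<Rightarrow> ('a \<Rightarrow> 'a set) \<Rightarrow> ('a \<Rightarrow> 'a set) \<Rightarrow> bool" where
  "alternating u x A B \<longleftrightarrow>
     sym {(w, n). n \<in> A w} \<and> sym {(w, n). n \<in> B w} \<and>
     (\<forall>w. A w \<subseteq> E `` {w} \<and> B w \<subseteq> E `` {w}) \<and>
     (\<forall>w. w \<noteq> u \<longrightarrow> w \<noteq> x \<longrightarrow> A w = {} \<and> B w = {} \<or> (\<exists>a b. a \<noteq> b \<and> A w = {a} \<and> B w = {b})) \<and>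
     B u = {} \<and> B x = {} \<and>
     (u \<noteq> x \<longrightarrow> (\<exists>p. A u = {p}) \<and> (\<exists>p. A x = {p})) \<and>
     (u = x \<longrightarrow> (\<exists>p p'. p \<noteq> p' \<and> A u = {p, p'}))"

lemma alternating_list:
  assumes walk: "walk p" and dist: "distinct (butlast p)" "distinct (tl p)"
    and len: "even (length p)" "length p \<ge> 2" "hd p = last p \<Longrightarrow> length p \<ge> 4"
  defines "S \<equiv> \<lambda>b w. {n. \<exists>i. Suc i < length p \<and> (even i \<longleftrightarrow> b) \<and>
      (w = p ! i \<and> n = p ! Suc i \<or> w = p ! Suc i \<and> n = p ! i)}"
  shows "alternating (hd p) (last p) (S True) (S False)"
proof -
  obtain n where n: "length p = Suc n" "odd n" using len by (cases "length p") auto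
  have pne: "p \<noteq> []" using n by auto
  have inj0: "i = j" if "i < n" "j < n" "p ! i = p ! j" for i j
    using that dist(1) n nth_eq_iff_index_eq[of "butlast p" i j] by (simp add: nth_butlast)
  have inj1: "i = j" if "i < n" "j < n" "p ! Suc i = p ! Suc j" for i j
    using that dist(2) n nth_eq_iff_index_eq[of "tl p" i j] by (simp add: nth_tl)
  have edge: "(p ! i, p ! Suc i) \<in> E" if "i < n" for i
    using that walk n by (simp add: successively_conv_nth)
  have S: "S b w = {m. \<exists>i<n. (even i \<longleftrightarrow> b) \<and> (w = p ! i \<and> m = p ! Suc i \<or> w = p ! Suc i \<and> m = p ! i)}" for b w
    unfolding S_def n by simp
  have hd: "hd p = p ! 0" and last: "last p = p ! n"
    using pne n by (simp_all add: hd_conv_nth last_conv_nth)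
  have sym: "sym {(w, m). m \<in> S b w}" for b unfolding S by (intro symI) blast
  have sub: "S b w \<subseteq> E `` {w}" for b w
    unfolding S using edge arcs_symmetric by blast
  have form: "S b w = {m. \<exists>i<n. (even i \<longleftrightarrow> b) \<and> (P i \<and> m = p ! Suc i \<or> Q i \<and> m = p ! i)}"
    if "\<And>i. i < n \<Longrightarrow> w = p ! i \<longleftrightarrow> P i" "\<And>i. i < n \<Longrightarrow> w = p ! Suc i \<longleftrightarrow> Q i" for b w P Q
    unfolding S using that by blast
  have inner: "S True w = {} \<and> S False w = {} \<or> (\<exists>a b. a \<noteq> b \<and> S True w = {a} \<and> S False w = {b})"
    if w: "w \<noteq> p ! 0" "w \<noteq> p ! n" for w
  proof (cases "w \<in> set p")
    case False
    then have no: "w \<noteq> p ! i" if "i \<le> n" for i using that n by auto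
    have "S b w = {m. \<exists>i<n. (even i \<longleftrightarrow> b) \<and> (False \<and> m = p ! Suc i \<or> False \<and> m = p ! i)}" for b
      by (rule form) (use no in auto)
    then show ?thesis by simp
  next
    case True
    then obtain j where j: "j < Suc n" "w = p ! j" unfolding in_set_conv_nth n by blast
    then have j0: "j \<noteq> 0" "j < n" using w by (metis, metis less_antisym)
    then obtain k where k: "j = Suc k" by (cases j) auto
    have S2: "S b w = {m. \<exists>i<n. (even i \<longleftrightarrow> b) \<and> (i = j \<and> m = p ! Suc i \<or> i = k \<and> m = p ! i)}" for b
      by (rule form) (use j j0 k inj0 inj1 in auto)
    have eq: "S (even j) w = {p ! Suc j}" "S (odd j) w = {p ! k}"
      unfolding S2 using j0 k by (auto intro: exI[of _ k] exI[of _ "Suc k"])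
    \<comment> \<open>The two neighbours could only coincide as first and last entry of a closed
      walk with two edges, which odd \<open>n\<close> excludes.\<close>
    have "p ! Suc j \<noteq> p ! k"
    proof
      assume e: "p ! Suc j = p ! k"
      show False
      proof (cases "Suc j < n")
        case True
        then show False using inj0[OF _ _ e] k by simp
      next
        case False
        then have "Suc j = n" using j0 by simp
        then have "k \<noteq> 0" using n k by (auto simp: odd_pos)
        then obtain l where "k = Suc l" by (cases k) auto
        then show False using inj1[of j l] e j0 k by auto
      qed
    qed
    then show ?thesis using eq by (cases "even j") auto
  qed
  have ends_ne: "S True (p ! 0) = {p ! 1}" "S False (p ! 0) = {}"
    "S True (p ! n) = {p ! (n - 1)}" "S False (p ! n) = {}" if ne: "p ! 0 \<noteq> p ! n"
  proof -
    have no: "p ! 0 \<noteq> p ! Suc i" if "i < n" for i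
      using inj0[of 0 "Suc i"] that ne by (cases "Suc i = n") auto
    have "S b (p ! 0) = {m. \<exists>i<n. (even i \<longleftrightarrow> b) \<and> (i = 0 \<and> m = p ! Suc i \<or> False \<and> m = p ! i)}" for b
      by (rule form) (use inj0 no n in \<open>auto simp: odd_pos\<close>)
    then show "S True (p ! 0) = {p ! 1}" "S False (p ! 0) = {}"
      using n by (auto simp: odd_pos)
    have no': "p ! n \<noteq> p ! i" if "i < n" for i
    proof (cases i)
      case (Suc l)
      then show ?thesis using inj1[of "n - 1" l] that n by (auto simp: odd_pos)
    qed (use ne in auto)
    have "S b (p ! n) = {m. \<exists>i<n. (even i \<longleftrightarrow> b) \<and> (False \<and> m = p ! Suc i \<or> i = n - 1 \<and> m = p ! i)}" for b
      by (rule form) (use inj1[of _ "n - 1"] no' n in \<open>auto simp: odd_pos\<close>)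
    then show "S True (p ! n) = {p ! (n - 1)}" "S False (p ! n) = {}"
      using n by (auto simp: odd_pos)
  qed
  have ends_eq: "S True (p ! 0) = {p ! 1, p ! (n - 1)} \<and> S False (p ! 0) = {} \<and> p ! 1 \<noteq> p ! (n - 1)"
    if eq: "p ! 0 = p ! n"
  proof -
    have n3: "n \<ge> 3" using len(3) eq hd last n by simp
    have S2: "S b (p ! 0) = {m. \<exists>i<n. (even i \<longleftrightarrow> b) \<and> (i = 0 \<and> m = p ! Suc i \<or> i = n - 1 \<and> m = p ! i)}" for b
    proof (rule form)
      fix i assume i: "i < n"
      show "p ! 0 = p ! i \<longleftrightarrow> i = 0" using inj0[of 0 i] i by auto
      show "p ! 0 = p ! Suc i \<longleftrightarrow> i = n - 1" using inj1[of "n - 1" i] i eq n3 by auto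
    qed
    have "S True (p ! 0) = {p ! 1, p ! (n - 1)}" "S False (p ! 0) = {}"
      unfolding S2 using n n3 by (auto intro: exI[of _ 0] exI[of _ "n - Suc 0"])
    moreover have "p ! 1 \<noteq> p ! (n - 1)" using inj0[of 1 "n - 1"] n n3 by auto
    ultimately show ?thesis by simp
  qed
  show ?thesis
    unfolding alternating_def hd last
  proof (intro conjI allI impI)
    show "S False (p ! 0) = {}" "S False (p ! n) = {}"
      using ends_ne ends_eq by (cases "p ! 0 = p ! n"; simp)+
    show "\<exists>q q'. q \<noteq> q' \<and> S True (p ! 0) = {q, q'}" if "p ! 0 = p ! n"
      using ends_eq[OF that] by blast
    show "sym {(w, m). m \<in> S True w}" "sym {(w, m). m \<in> S False w}" by (rule sym)+
    show "S True w \<subseteq> E `` {w}" "S False w \<subseteq> E `` {w}" for w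
      by (rule sub)+
    show "S True w = {} \<and> S False w = {} \<or> (\<exists>a b. a \<noteq> b \<and> S True w = {a} \<and> S False w = {b})"
      if "w \<noteq> p ! 0" "w \<noteq> p ! n" for w
      by (rule inner[OF that])
    show "\<exists>q. S True (p ! 0) = {q}" "\<exists>q. S True (p ! n) = {q}" if "p ! 0 \<noteq> p ! n"
      using ends_ne[OF that] by simp_all
  qed
qed

subsection \<open>Choice of the patterns\<close>

lemma alternating_subset:
  assumes "alternating u x A B"
  shows "A w \<subseteq> E `` {w}" "B w \<subseteq> E `` {w}"
  using assms by (simp_all add: alternating_def)

lemma alternating_inner:
  assumes "alternating u x A B" "w \<noteq> u" "w \<noteq> x"
  shows "A w = {} \<and> B w = {} \<or> (\<exists>a b. a \<noteq> b \<and> A w = {a} \<and> B w = {b})"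
  using assms by (simp add: alternating_def)

text \<open>For adjacent tails the path is the edge itself. It is then lowered at both tails, which
  keeps it from being left out on both sides later.\<close>

lemma alternating_exists:
  assumes odd_path: "\<And>u v. \<lbrakk>u \<in> pverts G; v \<in> pverts G; u \<noteq> v\<rbrakk> \<Longrightarrow> \<exists>p. path_between G u p v \<and> odd (vwalk_length p)"
    and ux: "u \<in> pverts G" "x \<in> pverts G" "(u, v) \<in> E"
  obtains A B where "alternating u x A B" "u \<noteq> x \<longrightarrow> (u, x) \<in> E \<longrightarrow> x \<in> A u"
proof -
  consider (eq) "u = x" | (adj) "u \<noteq> x" "(u, x) \<in> E" | (nonadj) "u \<noteq> x" "(u, x) \<notin> E" by blast
  then show thesis
  proof cases
    case eq
    obtain c where c: "cycle_list c" "hd c = u" using cycle_through[OF ux(3)] by blast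
    obtain c' where c': "cycle_list c'" "hd c' = u" "odd (length c')"
      by (rule odd_cycle_through[OF c(1) odd_path, unfolded c(2)])
    let ?p = "c' @ [u]"
    have ne: "c' \<noteq> []" using c'(1) by (auto simp: cycle_list_def)
    have "distinct (tl ?p)" using c' ne by (cases c') (auto simp: cycle_list_def)
    moreover have "walk ?p" using c' by (auto simp: cycle_list_def successively_append_iff)
    ultimately show thesis
      using that alternating_list[of ?p] c' ne eq by (auto simp: cycle_list_def)
  next
    case adj
    show thesis
      by (rule that[OF alternating_list[of "[u, x]", simplified]]) (use adj in auto)
  next
    case nonadj
    obtain p where p: "path_between G u p x" "odd (vwalk_length p)"
      using odd_path ux nonadj(1) by blast
    note pb = path_betweenE[OF p(1)]
    have "even (length p)" using p(2) pb(1) by simp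
    moreover from this have "length p \<ge> 2" using pb(1) by (cases p) (auto intro!: Suc_leI)
    moreover have "distinct (butlast p)" "distinct (tl p)"
      using pb(2) by (simp_all add: distinct_butlast distinct_tl)
    ultimately show thesis
      using that alternating_list[of p] pb nonadj by auto
  qed
qed

text \<open>The failure of a choice \<open>z\<close>, \<open>z'\<close>: the side \<open>T\<close>,
  away from both tails, is cut off when the edges from \<open>u\<close> to \<open>z\<close> and from
  \<open>x\<close> to \<open>z'\<close> are dropped.\<close>

definition separates :: "'a \<Rightarrow> 'a \<Rightarrow> 'a \<Rightarrow> 'a \<Rightarrow> 'a set \<Rightarrow> bool" where
  "separates u z x z' T \<longleftrightarrow> T \<noteq> {} \<and> T \<subseteq> pverts G \<and> u \<notin> T \<and> x \<notin> T \<and>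
     (\<forall>a b. (a, b) \<in> E \<longrightarrow> a \<in> T \<longrightarrow> b \<notin> T \<longrightarrow> {a, b} = {u, z} \<or> {a, b} = {x, z'})"

text \<open>Intersecting two such sides leaves \<open>{x, z'}\<close> as the only crossing edge.\<close>

lemma separates_unique:
  assumes ux: "u \<in> pverts G"
    and T1: "separates u z1 x z' T1" and T2: "separates u z2 x z' T2"
  shows "z1 = z2"
proof (rule ccontr)
  assume "z1 \<noteq> z2"
  \<comment> \<open>Otherwise the edge from \<open>u\<close> to \<open>z\<close> would be the only
    one leaving \<open>T\<close>, a bridge.\<close>
  have z': "z' \<in> T" if T: "separates u z x z' T" for z T
  proof -
    have "T \<subset> pverts G" using T ux by (auto simp: separates_def)
    then obtain a b where "(a, b) \<in> E" "a \<in> T" "b \<notin> T" "{a, b} \<noteq> {u, z}"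
      using crossing_arc[of T "{u, z}"] T unfolding separates_def by metis
    then show ?thesis using T unfolding separates_def doubleton_eq_iff by blast
  qed
  then have "z' \<in> T1 \<inter> T2" using T1 T2 by blast
  moreover have "T1 \<inter> T2 \<subset> pverts G" using T1 ux by (auto simp: separates_def)
  ultimately obtain a b where ab: "(a, b) \<in> E" "a \<in> T1 \<inter> T2" "b \<notin> T1 \<inter> T2" "{a, b} \<noteq> {x, z'}"
    using crossing_arc[of "T1 \<inter> T2" "{x, z'}"] by (metis empty_iff)
  \<comment> \<open>As \<open>u\<close> lies outside both sides, such an edge ends at
    \<open>u\<close> and leaves both of them, so its other end is both \<open>z1\<close> and
    \<open>z2\<close>.\<close>
  have *: "{a, b} = {u, z1}" if "b \<notin> T1" using that ab T1 unfolding separates_def by blast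
  have **: "{a, b} = {u, z2}" if "b \<notin> T2" using that ab T2 unfolding separates_def by blast
  have "u \<notin> T1" "u \<notin> T2" using T1 T2 by (auto simp: separates_def)
  then show False using * ** ab \<open>z1 \<noteq> z2\<close> unfolding doubleton_eq_iff by blast
qed

text \<open>
  At an end of degree 3 no pattern may connect all slots. \<open>Z w\<close> collects the neighbours
  left out at \<open>w\<close>; it is harmless if the graph stays connected without these incidences
  and with the two ends identified.
\<close>

definition harmless :: "(bool \<Rightarrow> 'a) \<Rightarrow> ('a \<Rightarrow> 'a set) \<Rightarrow> bool" where
  "harmless ep Z \<longleftrightarrow> (\<forall>a b. (a, b) \<in> E \<longrightarrow> b \<notin> Z a \<or> a \<notin> Z b) \<and>
     (\<forall>T. T \<noteq> {} \<longrightarrow> T \<subset> pverts G \<longrightarrow> (ep False \<in> T \<longleftrightarrow> ep True \<in> T) \<longrightarrow>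
        (\<exists>a b. (a, b) \<in> E \<and> a \<in> T \<and> b \<notin> T \<and> b \<notin> Z a \<and> a \<notin> Z b))"

text \<open>With distinct tails the end slots are the passage between the tails on which
  \<open>harmless\<close> relies. With coinciding tails they are left out, and each visit is reached
  through its neighbour slot from \<open>slot_Inl_ex\<close>.\<close>

definition main_slots :: "(bool \<Rightarrow> 'a) \<Rightarrow> ('a \<Rightarrow> 'a set) \<Rightarrow> 'a \<Rightarrow> ('a + bool) set" where
  "main_slots ep Z w = Inl ` (E `` {w} - Z w) \<union> {Inr c |c. ep c = w \<and> ep False \<noteq> ep True}"

text \<open>With one tail a single incidence is left out, which bridgelessness absorbs. With two
  tails \<open>z'\<close> is arbitrary, and by \<open>separates_unique\<close> at most one of two
  candidates \<open>z\<close> fails.\<close>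

lemma harmless_patterns:
  assumes deg: "\<And>w. w \<in> pverts G \<Longrightarrow> card (E `` {w}) \<ge> 3"
    and arcs: "\<And>c. (ep c, e c) \<in> E" and ne: "(ep False, e False) \<noteq> (ep True, e True)"
    and alt: "alternating (ep False) (ep True) A B"
    and adj: "\<lbrakk>ep False \<noteq> ep True; (ep False, ep True) \<in> E\<rbrakk> \<Longrightarrow> ep True \<in> A (ep False)"
  shows "\<exists>Z. harmless ep Z \<and> (\<forall>w\<in>pverts G. \<exists>z. z \<in> E `` {w} - Z w) \<and>
    (\<forall>w\<in>pverts G. \<exists>L. vertex_pattern e (E `` {w}) (A w) (B w) {c. ep c = w} (main_slots ep Z w) L)"
proof -
  have fin: "finite (E `` {w})" for w
    by (rule finite_subset[OF _ pair_finite_verts]) (auto dest: in_arcsD2)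
  have inner_pattern: "\<exists>L. vertex_pattern e (E `` {w}) (A w) (B w) {} (Inl ` (E `` {w})) L"
    if w: "w \<in> pverts G" "w \<noteq> ep False" "w \<noteq> ep True" for w
  proof -
    consider "A w = {}" "B w = {}" | a b where "a \<noteq> b" "A w = {a}" "B w = {b}"
      using alternating_inner[OF alt w(2,3)] by blast
    then show ?thesis
    proof cases
      case 1
      then show ?thesis using vertex_pattern_plain[of "E `` {w}" e] fin deg[OF w(1)] by simp
    next
      case 2
      then show ?thesis
        using vertex_pattern_inner[of "E `` {w}" a b e] fin deg[OF w(1)] alternating_subset[OF alt, of w] by simp
    qed
  qed
  show ?thesis
  proof (cases "ep False = ep True")
    case True
    define u where "u = ep False"
    have ep: "ep c = u" for c using True by (cases c) (auto simp: u_def)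
    have u: "u \<in> pverts G" using arcs[of False] ep in_arcsD1 by metis
    have alt': "B u = {}" "\<exists>p p'. p \<noteq> p' \<and> A u = {p, p'}" "A u \<subseteq> E `` {u}"
      using alt unfolding alternating_def ep by blast+
    then obtain p p' where p: "p \<noteq> p'" "A u = {p, p'}" by blast
    have "e c \<in> E `` {u}" for c using arcs[of c] ep[of c] by auto
    moreover have "e False \<noteq> e True" using ne ep by auto
    ultimately obtain z L where zL: "vertex_pattern e (E `` {u}) {p, p'} {} UNIV (Inl ` (E `` {u} - {z})) L"
      using vertex_pattern_both[of "E `` {u}" p p' e] fin deg[OF u] alt'(3) p by auto
    define Z where "Z w = (if w = u then {z} else {})" for w
    have "harmless ep Z"
      unfolding harmless_def
    proof (intro conjI allI impI)
      show "b \<notin> Z a \<or> a \<notin> Z b" if "(a, b) \<in> E" for a b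
        using no_loops'[OF that] by (auto simp: Z_def)
      show "\<exists>a b. (a, b) \<in> E \<and> a \<in> T \<and> b \<notin> T \<and> b \<notin> Z a \<and> a \<notin> Z b"
        if T: "T \<noteq> {}" "T \<subset> pverts G" for T
      proof -
        obtain a b where "(a, b) \<in> E" "a \<in> T" "b \<notin> T" "{a, b} \<noteq> {u, z}"
          by (rule crossing_arc[OF T])
        then show ?thesis by (intro exI[of _ a] exI[of _ b]) (auto simp: Z_def insert_commute)
      qed
    qed
    moreover have "\<exists>y. y \<in> E `` {w} - Z w" if "w \<in> pverts G" for w
    proof -
      have "\<not> E `` {w} \<subseteq> {z}" using deg[OF that] card_mono[of "{z}" "E `` {w}"] by auto
      then show ?thesis by (auto simp: Z_def)
    qed
    moreover have "\<exists>L. vertex_pattern e (E `` {w}) (A w) (B w) {c. ep c = w} (main_slots ep Z w) L"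
      if w: "w \<in> pverts G" for w
    proof (cases "w = u")
      case True
      then show ?thesis using zL p alt'(1) ep by (auto simp: main_slots_def Z_def)
    next
      case False
      then have C: "{c. ep c = w} = {}" "main_slots ep Z w = Inl ` (E `` {w})"
        using ep by (auto simp: main_slots_def Z_def)
      show ?thesis unfolding C using inner_pattern[OF w] False ep by metis
    qed
    ultimately show ?thesis by blast
  next
    case False
    have V: "ep c \<in> pverts G" for c using arcs in_arcsD1 by metis
    have uniq: "ep c = ep c' \<longleftrightarrow> c = c'" for c c' using False by (cases c; cases c') auto
    have A1: "\<exists>p. A (ep c) = {p}" "B (ep c) = {}" for c
      using alt False unfolding alternating_def by (cases c; simp)+
    \<comment> \<open>The ends where \<open>vertex_pattern_end\<close> fails: the lowered edge is
      the end arc itself, and the degree is 3.\<close>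
    define bad where "bad c \<longleftrightarrow> A (ep c) = {e c} \<and> card (E `` {ep c}) = 3" for c
    have two: "\<exists>z1 z2. z1 \<noteq> z2 \<and> {z1, z2} \<subseteq> E `` {ep c} - {e c}" for c
    proof -
      have "card (E `` {ep c} - {e c}) \<ge> 2" using deg[OF V, of c] by (auto simp: card_Diff_singleton_if)
      then obtain X where "X \<subseteq> E `` {ep c} - {e c}" "card X = 2" by (meson obtain_subset_with_card_n)
      then show ?thesis by (auto simp: card_2_iff)
    qed
    obtain z' where z': "z' \<in> E `` {ep True} - {e True}" using two[of True] by auto
    obtain z1 z2 where z12: "z1 \<noteq> z2" "{z1, z2} \<subseteq> E `` {ep False} - {e False}" using two[of False] by auto
    have "\<exists>z\<in>{z1, z2}. \<forall>T. \<not> separates (ep False) z (ep True) z' T"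
      using separates_unique[OF V[of False]] z12(1) by (metis insertI1 insertI2)
    then obtain z where z: "z \<in> E `` {ep False} - {e False}"
      "\<And>T. \<not> separates (ep False) z (ep True) z' T" using z12(2) by blast
    define ze where "ze c = (if c then z' else z)" for c
    have ze: "ze c \<in> E `` {ep c} - {e c}" for c using z z' by (simp add: ze_def)
    define Z where "Z w = {ze c |c. ep c = w \<and> bad c}" for w
    have Z_iff: "b \<in> Z a \<longleftrightarrow> (\<exists>c. bad c \<and> a = ep c \<and> b = ze c)" for a b by (auto simp: Z_def)
    have "harmless ep Z"
      unfolding harmless_def
    proof (intro conjI allI impI)
      fix a b assume ab: "(a, b) \<in> E"
      show "b \<notin> Z a \<or> a \<notin> Z b"
      proof (rule ccontr)
        assume "\<not> (b \<notin> Z a \<or> a \<notin> Z b)"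
        then obtain c c' where c: "bad c" "a = ep c" "b = ze c" "bad c'" "b = ep c'" "a = ze c'"
          unfolding Z_iff by blast
        have "c \<noteq> c'" using no_loops'[OF ab] unfolding c(2,5) by blast
        then have "c = False \<and> c' = True \<or> c = True \<and> c' = False" by auto
        then have "bad False" "ze False = ep True" using c by metis+
        \<comment> \<open>With \<open>bad False\<close> this gives
          \<open>e False = ep True = ze False\<close>, but \<open>ze\<close> was chosen different
          from \<open>e\<close>.\<close>
        moreover have "ep True \<in> A (ep False)"
          using adj[OF False] ze[of False] \<open>ze False = ep True\<close> by auto
        ultimately show False using ze[of False] by (auto simp: bad_def)
      qed
    next
      fix T assume T: "T \<noteq> {}" "T \<subset> pverts G" "ep False \<in> T \<longleftrightarrow> ep True \<in> T"
      show "\<exists>a b. (a, b) \<in> E \<and> a \<in> T \<and> b \<notin> T \<and> b \<notin> Z a \<and> a \<notin> Z b"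
      proof (rule ccontr)
        assume no: "\<not> ?thesis"
        \<comment> \<open>Complementing if necessary gives a side without the tails, as
          \<open>separates\<close> demands.\<close>
        define T' where "T' = (if ep False \<in> T then pverts G - T else T)"
        have no': "\<exists>c. bad c \<and> {a, b} = {ep c, ze c}" if "(a, b) \<in> E" "a \<in> T'" "b \<notin> T'" for a b
        proof -
          have "b \<in> Z a \<or> a \<in> Z b"
          proof (cases "ep False \<in> T")
            case True
            then have "b \<in> T" "a \<notin> T" using that in_arcsD2[OF that(1)] by (auto simp: T'_def)
            then show ?thesis using no that(1) arcs_symmetric by blast
          next
            case False
            then show ?thesis using no that by (auto simp: T'_def)
          qed
          then show ?thesis unfolding Z_iff by auto
        qed
        have T': "T' \<noteq> {}" "T' \<subset> pverts G" "ep False \<notin> T'" "ep True \<notin> T'"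
          using T V by (auto simp: T'_def)
        show False
        proof (cases "bad False")
          case True
          have "separates (ep False) z (ep True) z' T'"
            unfolding separates_def using T' no' by (auto simp: ze_def ex_bool_eq)
          then show False using z(2) by blast
        next
          case False
          then have "{a, b} = {ep True, ze True}" if "(a, b) \<in> E" "a \<in> T'" "b \<notin> T'" for a b
            using no'[OF that] by (metis (full_types))
          then show False using crossing_arc[OF T'(1,2), of "{ep True, ze True}"] by metis
        qed
      qed
    qed
    moreover have "\<exists>y. y \<in> E `` {w} - Z w" if "w \<in> pverts G" for w
    proof -
      have "Z w \<subseteq> {ze (w = ep True)}" using uniq by (auto simp: Z_def)
      moreover have "\<not> E `` {w} \<subseteq> {ze (w = ep True)}"
        using deg[OF that] card_mono[of "{ze (w = ep True)}" "E `` {w}"] by auto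
      ultimately show ?thesis by blast
    qed
    moreover have "\<exists>L. vertex_pattern e (E `` {w}) (A w) (B w) {c. ep c = w} (main_slots ep Z w) L"
      if w: "w \<in> pverts G" for w
    proof (cases "\<exists>c. w = ep c")
      case True
      then obtain c where c: "w = ep c" by blast
      obtain p where p: "A w = {p}" using A1 c by blast
      have pE: "p \<in> E `` {w}" using alternating_subset(1)[OF alt, of w] p by simp
      have C: "{c. ep c = w} = {c}" using uniq c by auto
      have Zw: "Z w = (if bad c then {ze c} else {})" using uniq c by (auto simp: Z_def)
      have M: "main_slots ep Z w = insert (Inr c) (Inl ` (E `` {w} - Z w))"
        using uniq c False by (auto simp: main_slots_def)
      have B: "B w = {}" using A1 c by blast
      show ?thesis
      proof (cases "bad c")
        case True
        then have "A w = {e c}" "card (E `` {w}) = 3" using c by (auto simp: bad_def)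
        then show ?thesis
          unfolding C M B using vertex_pattern_bad_end[of "E `` {w}" e c "ze c"] ze[of c] arcs[of c] Zw True c by auto
      next
        case False
        then have "p \<noteq> e c \<or> card (E `` {w}) \<ge> 4" using p c deg[OF w] by (auto simp: bad_def)
        then show ?thesis
          unfolding C M B p using vertex_pattern_end[of "E `` {w}" p e c] pE fin deg[OF w] arcs[of c] Zw False c by auto
      qed
    next
      case nw: False
      then have C: "{c. ep c = w} = {}" "main_slots ep Z w = Inl ` (E `` {w})"
        by (auto simp: main_slots_def Z_def)
      have "w \<noteq> ep False" "w \<noteq> ep True" using nw by blast+
      then show ?thesis unfolding C using inner_pattern w by blast
    qed
    ultimately show ?thesis by blast
  qed
qed

end

subsection \<open>The Hamilton path\<close>

definition slot :: "'a link \<Rightarrow> bool \<Rightarrow> 'a + bool" where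
  "slot t \<beta> = (if \<beta> then snd (snd t) else fst (snd t))"

lemma card_link_slots:
  assumes "distinct (map fst L)"
  shows "card {d. fst d \<in> set L \<and> slot (fst d) (snd d) = \<sigma>} = count (link_slots L) \<sigma>"
  using assms
proof (induction L)
  case Nil
  then show ?case by (simp add: link_slots_def)
next
  case (Cons t L)
  let ?D = "\<lambda>M. {d. fst d \<in> M \<and> slot (fst d) (snd d) = \<sigma>}"
  let ?T = "(if fst (snd t) = \<sigma> then {(t, False)} else {}) \<union> (if snd (snd t) = \<sigma> then {(t, True)} else {})"
  have fin: "finite (?D (set L))"
    by (rule finite_subset[of _ "set L \<times> UNIV"]) auto
  have "?D (set (t # L)) = ?T \<union> ?D (set L)"
    by (auto simp: slot_def split: if_splits)
  moreover have "t \<notin> set L" using Cons.prems by auto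
  then have "?T \<inter> ?D (set L) = {}" by (auto split: if_splits)
  moreover have "card ?T = of_bool (fst (snd t) = \<sigma>) + of_bool (snd (snd t) = \<sigma>)" by simp
  moreover have "finite ?T" by simp
  ultimately have "card (?D (set (t # L))) =
      of_bool (fst (snd t) = \<sigma>) + of_bool (snd (snd t) = \<sigma>) + card (?D (set L))"
    using fin by (simp only: card_Un_disjoint)
  also have "\<dots> = count (link_slots (t # L)) \<sigma>"
    using Cons by (simp add: link_slots_def)
  finally show ?case .
qed

lemma link_slots_Cons: "link_slots (t # L) = {#slot t \<beta>, slot t (\<not> \<beta>)#} + link_slots L"
  by (cases \<beta>) (simp_all add: link_slots_def slot_def)

lemma link_slots_subset: "t \<in> set L \<Longrightarrow> {#slot t \<beta>, slot t (\<not> \<beta>)#} \<subseteq># link_slots L"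
proof (induction L)
  case (Cons t' L)
  then show ?case
    by (metis link_slots_Cons mset_subset_eq_add_left mset_subset_eq_add_right set_ConsD subset_mset.order_trans)
qed simp

fun global_slot :: "'a \<Rightarrow> 'a + bool \<Rightarrow> ('a \<times> 'a) + bool" where
  "global_slot w (Inl n) = Inl (w, n)"
| "global_slot w (Inr c) = Inr c"

fun swap_slot :: "('a \<times> 'a) + bool \<Rightarrow> ('a \<times> 'a) + bool" where
  "swap_slot (Inl (w, n)) = Inl (n, w)"
| "swap_slot (Inr c) = Inr (\<not> c)"

definition node_slot :: "('a \<times> 'a link) \<times> bool \<Rightarrow> ('a \<times> 'a) + bool" where
  "node_slot d = global_slot (fst (fst d)) (slot (snd (fst d)) (snd d))"

interpretation node: slot_types node_slot swap_slot
proof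
  show "swap_slot (swap_slot t) = t" for t :: "('a \<times> 'a) + bool"
    by (cases t rule: swap_slot.cases) auto
qed

locale linked_graph = bridgeless_graph +
  fixes ep e :: "bool \<Rightarrow> 'a" and A B Z :: "'a \<Rightarrow> 'a set" and L :: "'a \<Rightarrow> 'a link list"
  assumes arcs: "\<And>c. (ep c, e c) \<in> E" and ends_ne: "(ep False, e False) \<noteq> (ep True, e True)"
    and alt: "alternating (ep False) (ep True) A B"
    and harmless: "harmless ep Z"
    and main_ex: "\<And>w. w \<in> pverts G \<Longrightarrow> \<exists>z. z \<in> E `` {w} - Z w"
    and pattern: "\<And>w. w \<in> pverts G \<Longrightarrow>
      vertex_pattern e (E `` {w}) (A w) (B w) {c. ep c = w} (main_slots ep Z w) (L w)"
begin

definition nodes :: "('a \<times> 'a link) set" where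
  "nodes = Sigma (pverts G) (\<lambda>w. set (L w))"

definition arc_of :: "'a \<times> 'a link \<Rightarrow> 'a \<times> 'a" where
  "arc_of n = (fst n, fst (snd n))"

lemma link_pattern: "w \<in> pverts G \<Longrightarrow> link_pattern e (E `` {w}) (link_slots (L w)) (main_slots ep Z w) (L w)"
  using pattern by (simp add: vertex_pattern_def)

lemma count_Inl: "w \<in> pverts G \<Longrightarrow> count (link_slots (L w)) (Inl n) =
    (if n \<notin> E `` {w} then 0 else if n \<in> A w then 1 else if n \<in> B w then 3 else 2)"
  using pattern by (simp add: vertex_pattern_def)

lemma count_Inr: "w \<in> pverts G \<Longrightarrow> count (link_slots (L w)) (Inr c) = of_bool (ep c = w)"
  using pattern by (simp add: vertex_pattern_def)

lemma distinct_labels: "w \<in> pverts G \<Longrightarrow> distinct (map fst (L w))"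
  using link_pattern by (simp add: link_pattern_def)

lemma labels: "w \<in> pverts G \<Longrightarrow> fst ` set (L w) = E `` {w}"
  using link_pattern by (simp add: link_pattern_def)

lemma slot_fits:
  assumes "w \<in> pverts G" "t \<in> set (L w)"
  shows "fits e (fst t) (slot t \<beta>)"
  using link_pattern[OF assms(1)] assms(2) by (cases t) (auto simp: link_pattern_def slot_def)

lemma slot_mem:
  assumes "t \<in> set (L w)"
  shows "count (link_slots (L w)) (slot t \<beta>) > 0"
proof -
  have "slot t \<beta> \<in># {#slot t \<beta>, slot t (\<not> \<beta>)#}" by simp
  then show ?thesis using link_slots_subset[OF assms, of \<beta>] by (metis count_greater_zero_iff mset_subset_eqD)
qed

lemma slot_InlD:
  assumes "w \<in> pverts G" "t \<in> set (L w)" "slot t \<beta> = Inl n"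
  shows "(w, n) \<in> E" "n \<noteq> fst t"
  using slot_mem[OF assms(2), of \<beta>] slot_fits[OF assms(1,2), of \<beta>] assms(3) count_Inl[OF assms(1)]
  by (auto split: if_splits)

lemma slot_InrD:
  assumes "w \<in> pverts G" "t \<in> set (L w)" "slot t \<beta> = Inr c"
  shows "ep c = w" "fst t = e c"
  using slot_mem[OF assms(2), of \<beta>] slot_fits[OF assms(1,2), of \<beta>] assms(3) count_Inr[OF assms(1)]
  by (auto split: if_splits)

text \<open>A visit with two end slots would use one end twice or belong to both end arcs, which
  differ.\<close>

lemma slot_Inl_ex:
  assumes "w \<in> pverts G" "t \<in> set (L w)"
  obtains \<beta> n where "slot t \<beta> = Inl n"
proof -
  have False if F: "slot t False = Inr c" and T: "slot t True = Inr c'" for c c'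
  proof (cases "c = c'")
    case True
    have "count {#slot t False, slot t (\<not> False)#} (Inr c) \<le> count (link_slots (L w)) (Inr c)"
      by (rule mset_subset_eq_count[OF link_slots_subset[OF assms(2)]])
    then show False using F T True count_Inr[OF assms(1), of c] by (simp add: of_bool_def split: if_splits)
  next
    case False
    have "ep c = ep c'" "e c = e c'"
      using slot_InrD[OF assms F] slot_InrD[OF assms T] by auto
    then show False using ends_ne False by (cases c; cases c') auto
  qed
  then show thesis using that by (metis old.sum.exhaust)
qed

lemma slots_restrict:
  assumes "w \<in> pverts G" "\<And>n \<beta>. \<lbrakk>n \<in> nodes; node_slot (n, \<beta>) = \<tau>\<rbrakk> \<Longrightarrow> fst n = w" "\<tau> = global_slot w \<sigma>"
  shows "card (node.slots nodes \<tau>) = count (link_slots (L w)) \<sigma>"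
proof -
  have inj: "global_slot w \<sigma> = global_slot w \<sigma>' \<longleftrightarrow> \<sigma> = \<sigma>'" for \<sigma>'
    by (cases \<sigma>; cases \<sigma>') auto
  have "node.slots nodes \<tau> = (\<lambda>d. ((w, fst d), snd d)) ` {d. fst d \<in> set (L w) \<and> slot (fst d) (snd d) = \<sigma>}"
    (is "?L = ?f ` ?R")
  proof (intro set_eqI iffI)
    fix d assume "d \<in> ?L"
    then have d: "fst d \<in> nodes" "node_slot d = \<tau>" by (auto simp: node.slots_def)
    then have "fst (fst d) = w" using assms(2)[of "fst d" "snd d"] by simp
    moreover from this have "slot (snd (fst d)) (snd d) = \<sigma>"
      using d(2) assms(3) inj by (metis node_slot_def)
    ultimately have "(snd (fst d), snd d) \<in> ?R" "d = ?f (snd (fst d), snd d)"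
      using d(1) by (auto simp: nodes_def prod_eq_iff)
    then show "d \<in> ?f ` ?R" by blast
  next
    fix d assume "d \<in> ?f ` ?R"
    then show "d \<in> ?L" using assms by (auto simp: node.slots_def nodes_def node_slot_def)
  qed
  moreover have "inj_on ?f ?R" by (auto simp: inj_on_def prod_eq_iff)
  ultimately show ?thesis
    using card_link_slots[OF distinct_labels[OF assms(1)]] by (simp add: card_image)
qed

lemma node_slot_Inl:
  assumes "n \<in> nodes" "node_slot (n, \<beta>) = Inl (a, b)"
  shows "fst n = a" "(a, b) \<in> E" "b \<noteq> snd (arc_of n)"
proof -
  have n: "fst n \<in> pverts G" "snd n \<in> set (L (fst n))" using assms(1) by (auto simp: nodes_def)
  have s: "slot (snd n) \<beta> = Inl b" "fst n = a"
    using assms(2) by (cases "slot (snd n) \<beta>"; auto simp: node_slot_def)+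
  show "fst n = a" "(a, b) \<in> E" "b \<noteq> snd (arc_of n)"
    using slot_InlD[OF n s(1)] s(2) by (auto simp: arc_of_def)
qed

lemma node_slot_Inr:
  assumes "n \<in> nodes" "node_slot (n, \<beta>) = Inr c"
  shows "arc_of n = (ep c, e c)"
proof -
  have n: "fst n \<in> pverts G" "snd n \<in> set (L (fst n))" using assms(1) by (auto simp: nodes_def)
  have s: "slot (snd n) \<beta> = Inr c"
    using assms(2) by (cases "slot (snd n) \<beta>"; auto simp: node_slot_def)
  show ?thesis using slot_InrD[OF n s] by (auto simp: arc_of_def)
qed

lemma card_slots_Inl:
  "card (node.slots nodes (Inl (w, n))) =
    (if n \<notin> E `` {w} then 0 else if n \<in> A w then 1 else if n \<in> B w then 3 else 2)"
proof (cases "w \<in> pverts G")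
  case True
  have "card (node.slots nodes (Inl (w, n))) = count (link_slots (L w)) (Inl n)"
    by (rule slots_restrict[OF True]) (erule (1) node_slot_Inl(1), simp)
  then show ?thesis by (simp only: count_Inl[OF True])
next
  case False
  have "d \<notin> node.slots nodes (Inl (w, n))" for d
  proof
    assume "d \<in> node.slots nodes (Inl (w, n))"
    then have "fst d \<in> nodes" "node_slot (fst d, snd d) = Inl (w, n)" by (simp_all add: node.slots_def)
    from node_slot_Inl(2)[OF this] show False using False in_arcsD1 by blast
  qed
  then have "node.slots nodes (Inl (w, n)) = {}" by blast
  moreover have "n \<notin> E `` {w}" using False in_arcsD1 by blast
  ultimately show ?thesis by simp
qed

lemma card_slots_Inr: "card (node.slots nodes (Inr c)) = 1"
proof -
  have V: "ep c \<in> pverts G" using arcs in_arcsD1 by blast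
  have "fst n = ep c" if "n \<in> nodes" "node_slot (n, \<beta>) = Inr c" for n \<beta>
    using node_slot_Inr[OF that] by (simp add: arc_of_def)
  then have "card (node.slots nodes (Inr c)) = count (link_slots (L (ep c))) (Inr c)"
    by (rule slots_restrict[OF V]) simp_all
  then show ?thesis by (simp add: count_Inr[OF V])
qed

text \<open>The slots at \<open>w\<close> towards \<open>n\<close> are counted by the multiplicity
  of the edge, symmetric because \<open>A\<close>, \<open>B\<close> and the arcs are; each end has
  exactly one slot.\<close>

lemma balanced_nodes: "node.balanced nodes"
  unfolding node.balanced_def
proof (intro conjI allI impI)
  show "finite nodes" by (simp add: nodes_def pair_finite_verts)
  show "swap_slot (node_slot d) \<noteq> node_slot d" if d: "fst d \<in> nodes" for d
  proof (cases "node_slot d")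
    case (Inl ab)
    then show ?thesis
      using node_slot_Inl(2)[of "fst d" "snd d" "fst ab" "snd ab"] d no_loops' by (cases ab) auto
  qed auto
  have sym: "sym {(w, n). n \<in> A w}" "sym {(w, n). n \<in> B w}"
    using alt by (simp_all add: alternating_def)
  have symAB: "n \<in> A w \<longleftrightarrow> w \<in> A n" "n \<in> B w \<longleftrightarrow> w \<in> B n" for n w
    using symD[OF sym(1), of w n] symD[OF sym(1), of n w] symD[OF sym(2), of w n] symD[OF sym(2), of n w]
    by auto
  have symE: "n \<in> E `` {w} \<longleftrightarrow> w \<in> E `` {n}" for n w using arcs_symmetric by blast
  have "card (node.slots nodes (Inl (w, n))) = card (node.slots nodes (Inl (n, w)))" for w n
    by (simp only: card_slots_Inl symAB[of n w] symE[of n w])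
  then show "card (node.slots nodes (swap_slot \<tau>)) = card (node.slots nodes \<tau>)" for \<tau>
    by (cases \<tau> rule: swap_slot.cases) (simp_all only: swap_slot.simps card_slots_Inr)
qed

text \<open>The vertices whose main slots lie in \<open>U\<close> are all or none, by
  \<open>harmless\<close>. An edge left out on one side is reached by swapping from the other, so
  all edges behave alike, and every node has a neighbour slot.\<close>

lemma connected_slots:
  assumes sw: "\<And>t. t \<in> U \<Longrightarrow> swap_slot t \<in> U"
    and cl: "\<And>d. \<lbrakk>fst d \<in> nodes; node_slot d \<in> U\<rbrakk> \<Longrightarrow> node_slot (flip d) \<in> U"
    and ex: "\<exists>d. fst d \<in> nodes \<and> node_slot d \<in> U" and n: "n \<in> nodes"
  shows "\<exists>d. fst d = n \<and> node_slot d \<in> U"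
proof -
  define Uw where "Uw w = {\<sigma>. global_slot w \<sigma> \<in> U}" for w
  have Uw_Inl: "Inl b \<in> Uw a \<longleftrightarrow> Inl (a, b) \<in> U" and Uw_Inr: "Inr c \<in> Uw a \<longleftrightarrow> Inr c \<in> U" for a b c
    by (simp_all add: Uw_def)
  have sw_Inl: "Inl (a, b) \<in> U \<longleftrightarrow> Inl (b, a) \<in> U" for a b
    using sw[of "Inl (a, b)"] sw[of "Inl (b, a)"] by auto
  have sw_Inr: "Inr False \<in> U \<longleftrightarrow> Inr True \<in> U"
    using sw[of "Inr False"] sw[of "Inr True"] by auto
  have flip: "node_slot (m, \<beta>) \<in> U \<longleftrightarrow> node_slot (m, \<not> \<beta>) \<in> U" if "m \<in> nodes" for m \<beta>
    using cl[of "(m, \<beta>)"] cl[of "(m, \<not> \<beta>)"] that by (auto simp: flip_def)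
  have closed: "link_closed (L w) (Uw w)" if w: "w \<in> pverts G" for w
    unfolding link_closed_def
  proof clarify
    fix l a b assume "(l, a, b) \<in> set (L w)"
    then have "(w, l, a, b) \<in> nodes" using w by (simp add: nodes_def)
    from flip[OF this, of False] show "a \<in> Uw w \<longleftrightarrow> b \<in> Uw w"
      by (simp add: node_slot_def slot_def Uw_def)
  qed
  define g where "g w \<longleftrightarrow> main_slots ep Z w \<subseteq> Uw w" for w
  have dich: "\<sigma> \<in> Uw w \<longleftrightarrow> g w" if w: "w \<in> pverts G" "\<sigma> \<in> main_slots ep Z w" for w \<sigma>
  proof -
    have "main_slots ep Z w \<subseteq> Uw w \<or> main_slots ep Z w \<inter> Uw w = {}"
      using link_pattern[OF w(1)] closed[OF w(1)] sw_Inr Uw_Inr unfolding link_pattern_def by blast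
    then show ?thesis using w(2) unfolding g_def by blast
  qed
  have g_edge: "Inl (a, b) \<in> U \<longleftrightarrow> g a" if "(a, b) \<in> E" "b \<notin> Z a" for a b
  proof -
    have "Inl b \<in> main_slots ep Z a" using that by (auto simp: main_slots_def)
    from dich[OF in_arcsD1[OF that(1)] this] show ?thesis by (simp add: Uw_Inl)
  qed
  have g_ends: "g (ep False) \<longleftrightarrow> g (ep True)"
  proof (cases "ep False = ep True")
    case False
    have "Inr c \<in> U \<longleftrightarrow> g (ep c)" for c
    proof -
      have "Inr c \<in> main_slots ep Z (ep c)" using False by (auto simp: main_slots_def)
      from dich[OF in_arcsD1[OF arcs] this] show ?thesis by (simp add: Uw_Inr)
    qed
    then show ?thesis using sw_Inr by metis
  qed simp
  define T where "T = {w \<in> pverts G. g w}"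
  have "ep c \<in> pverts G" for c using arcs in_arcsD1 by blast
  then have "ep False \<in> T \<longleftrightarrow> ep True \<in> T" using g_ends by (simp add: T_def)
  moreover have "\<not> (\<exists>a b. (a, b) \<in> E \<and> a \<in> T \<and> b \<notin> T \<and> b \<notin> Z a \<and> a \<notin> Z b)"
  proof clarify
    fix a b assume ab: "(a, b) \<in> E" "a \<in> T" "b \<notin> T" "b \<notin> Z a" "a \<notin> Z b"
    then have "g a" "\<not> g b" using in_arcsD2 by (auto simp: T_def)
    then show False using g_edge[OF ab(1,4)] g_edge[OF arcs_symmetric[OF ab(1)] ab(5)] sw_Inl by blast
  qed
  moreover have "T \<subseteq> pverts G" by (auto simp: T_def)
  ultimately have T: "T = {} \<or> T = pverts G" using harmless unfolding harmless_def by blast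
  have all_edges: "Inl (a, b) \<in> U \<longleftrightarrow> T = pverts G" if ab: "(a, b) \<in> E" for a b
  proof -
    have V: "a \<in> pverts G" "b \<in> pverts G" using ab in_arcsD1 in_arcsD2 by blast+
    then have "g a \<longleftrightarrow> T = pverts G" "g b \<longleftrightarrow> T = pverts G" using T by (auto simp: T_def)
    moreover have "b \<notin> Z a \<or> a \<notin> Z b" using harmless ab unfolding harmless_def by blast
    ultimately show ?thesis
      using g_edge[OF ab] g_edge[OF arcs_symmetric[OF ab]] sw_Inl by blast
  qed
  have node: "node_slot (m, \<beta>) \<in> U \<longleftrightarrow> T = pverts G" if m: "m \<in> nodes" for m \<beta>
  proof -
    have "fst m \<in> pverts G" "snd m \<in> set (L (fst m))" using m by (auto simp: nodes_def)
    then obtain \<beta>' b where s: "slot (snd m) \<beta>' = Inl b" by (rule slot_Inl_ex)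
    then have "node_slot (m, \<beta>') = Inl (fst m, b)" by (simp add: node_slot_def)
    then have "node_slot (m, \<beta>') \<in> U \<longleftrightarrow> T = pverts G"
      using all_edges node_slot_Inl(2)[OF m] by metis
    then show ?thesis using flip[OF m, of \<beta>] by (cases "\<beta> = \<beta>'") auto
  qed
  from ex obtain m \<beta> where "m \<in> nodes" "node_slot (m, \<beta>) \<in> U" by auto
  then have "node_slot (n, True) \<in> U" using node n by blast
  then show ?thesis by (intro exI[of _ "(n, True)"]) simp
qed

lemma arc_of_inj: "inj_on arc_of nodes"
proof (rule inj_onI)
  fix m n assume mn: "m \<in> nodes" "n \<in> nodes" "arc_of m = arc_of n"
  then have "inj_on fst (set (L (fst n)))"
    using distinct_labels[of "fst n"] by (auto simp: nodes_def distinct_map)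
  then show "m = n"
    using mn by (auto simp: nodes_def arc_of_def prod_eq_iff dest: inj_onD)
qed

lemma arc_of_image: "arc_of ` nodes = E"
proof (intro set_eqI iffI)
  fix a assume "a \<in> arc_of ` nodes"
  then obtain n where n: "n \<in> nodes" "a = arc_of n" by blast
  then have "fst (snd n) \<in> fst ` set (L (fst n))" "fst n \<in> pverts G" by (auto simp: nodes_def)
  then show "a \<in> E" using labels n by (auto simp: arc_of_def)
next
  fix a assume "a \<in> E"
  then have "fst a \<in> pverts G" "snd a \<in> E `` {fst a}" using in_arcsD1[of "fst a" "snd a"] by auto
  then have "snd a \<in> fst ` set (L (fst a))" "fst a \<in> pverts G" using labels by simp_all
  then obtain t where "t \<in> set (L (fst a))" "snd a = fst t" by blast
  then show "a \<in> arc_of ` nodes"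
    using \<open>fst a \<in> pverts G\<close> by (intro image_eqI[of _ _ "(fst a, t)"]) (auto simp: arc_of_def nodes_def prod_eq_iff)
qed

lemma joins_adjacent:
  assumes d: "fst d \<in> nodes" "fst d' \<in> nodes" and j: "node.joins d d'"
    and s: "node_slot d' = Inl s"
  shows "(arc_of (fst d), arc_of (fst d')) \<in> parcs (three_arc_graph G)"
proof -
  obtain y x where yx: "node_slot d' = Inl (y, x)" using s by (cases s) auto
  then have "swap_slot (node_slot (flip d)) = Inl (y, x)" using j by (simp add: node.joins_def)
  then have xy: "node_slot (flip d) = Inl (x, y)" by (cases "node_slot (flip d)" rule: swap_slot.cases) auto
  have 1: "fst (fst d') = y" "(y, x) \<in> E" "x \<noteq> snd (arc_of (fst d'))"
    using node_slot_Inl[OF d(2), of "snd d'" y x] yx by auto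
  have 2: "fst (fst d) = x" "(x, y) \<in> E" "y \<noteq> snd (arc_of (fst d))"
    using node_slot_Inl[OF d(1), of "\<not> snd d" x y] xy by (auto simp: flip_def)
  have arcs: "arc_of (fst d) \<in> E" "arc_of (fst d') \<in> E" using arc_of_image d by blast+
  obtain v w where v: "arc_of (fst d) = (x, v)" and w: "arc_of (fst d') = (y, w)"
    using 1 2 by (simp add: arc_of_def)
  have e: "(x, v) \<in> E" "(y, w) \<in> E" "v \<noteq> y" "w \<noteq> x" using arcs v w 1 2 by auto
  have "(v, x) \<in> E" using e(1) arcs_symmetric by blast
  then have "three_arc G v x y w"
    using e 2(2) in_arcsD1 in_arcsD2 no_loops'
    unfolding three_arc_def vpath_def vwalk_def by auto
  then show ?thesis unfolding v w three_arc_graph_def using e by auto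
qed

text \<open>The closed strand is entered at its unique \<open>Inr False\<close> slot. Its closing
  joint then comes from \<open>Inr True\<close>, so the list runs from the first end arc to the
  second.\<close>

lemma hamilton_path: "\<exists>p. path_between (three_arc_graph G) (ep False, e False) p (ep True, e True) \<and>
    set p = pverts (three_arc_graph G)"
proof -
  have ne: "nodes \<noteq> {}" using arc_of_image arcs by blast
  have conn: "\<forall>n\<in>nodes. \<exists>d. fst d = n \<and> node_slot d \<in> U"
    if "\<And>t. t \<in> U \<Longrightarrow> swap_slot t \<in> U" "\<And>d. \<lbrakk>fst d \<in> nodes; node_slot d \<in> U\<rbrakk> \<Longrightarrow> node_slot (flip d) \<in> U"
      "\<exists>d. fst d \<in> nodes \<and> node_slot d \<in> U" for U
    using connected_slots[OF that] by blast
  obtain xs where xs: "node.closed_strand xs" "fst ` set xs = nodes"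
    by (rule node.closed_strand_covering[OF balanced_nodes ne conn])
  obtain s where "node.slots nodes (Inr False) = {s}"
    using card_slots_Inr card_1_singletonE by blast
  then have s: "fst s \<in> nodes" "node_slot s = Inr False"
    and s_unique: "\<And>d. \<lbrakk>fst d \<in> nodes; node_slot d = Inr False\<rbrakk> \<Longrightarrow> d = s"
    unfolding node.slots_def by blast+
  obtain ys where ys: "node.closed_strand ys" "hd ys = s" "fst ` set ys = nodes"
    using node.closed_strand_start[OF xs(1), of s] s xs(2) by metis
  have strand: "ys \<noteq> []" "distinct (map fst ys)" "successively node.joins ys" "node.joins (last ys) s"
    using ys unfolding node.closed_strand_def node.strand_def by auto
  obtain zs where zs: "ys = s # zs" using strand(1) ys(2) by (cases ys) auto
  have in_nodes: "fst d \<in> nodes" if "d \<in> set ys" for d using that ys(3) by blast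
  define p where "p = map (\<lambda>d. arc_of (fst d)) ys"
  have "arc_of (fst s) = (ep False, e False)"
    using node_slot_Inr[of "fst s" "snd s" False] s by simp
  then have hd: "hd p = (ep False, e False)" using strand(1) ys(2) by (simp add: p_def hd_map)
  have "node_slot (flip (last ys)) = Inr True"
    using strand(4) s(2) by (cases "node_slot (flip (last ys))" rule: swap_slot.cases) (auto simp: node.joins_def)
  then have "arc_of (fst (last ys)) = (ep True, e True)"
    using node_slot_Inr[of "fst (last ys)" "\<not> snd (last ys)" True] in_nodes strand(1) by (simp add: flip_def)
  then have last: "last p = (ep True, e True)" using strand(1) by (simp add: p_def last_map)
  have set: "set p = E"
    using ys(3) arc_of_image unfolding p_def by (metis image_image list.set_map)
  have "inj_on fst (set ys)" "distinct ys" using strand(2) by (simp_all add: distinct_map)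
  moreover have "inj_on arc_of (fst ` set ys)" using arc_of_inj ys(3) by simp
  ultimately have "distinct p"
    using comp_inj_on[of fst "set ys" arc_of] by (simp add: p_def distinct_map o_def)
  moreover have "(arc_of (fst (ys ! i)), arc_of (fst (ys ! Suc i))) \<in> parcs (three_arc_graph G)"
    if i: "Suc i < length ys" for i
  proof -
    let ?d = "ys ! i" and ?d' = "ys ! Suc i"
    have mem: "?d \<in> set ys" "?d' \<in> set ys" using i by simp_all
    have j: "node.joins ?d ?d'" using strand(3) i by (simp add: successively_conv_nth)
    have "zs ! i \<in> set zs" "fst s \<notin> fst ` set zs" using i strand(2) by (simp_all add: zs)
    then have ne: "fst ?d' \<noteq> fst s" by (metis image_eqI nth_Cons_Suc zs)
    show ?thesis
    proof (cases "node_slot ?d'")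
      case (Inl a)
      then show ?thesis using joins_adjacent[OF _ _ j] in_nodes mem by blast
    next
      case (Inr c)
      \<comment> \<open>An end joint inside the list would leave a node through the slot
        \<open>s\<close>; that node is the first one, which is entered through \<open>s\<close> and
        so left through the other slot.\<close>
      have "c = True" using s_unique[of ?d'] in_nodes[OF mem(2)] Inr ne by (cases c) auto
      then have "node_slot (flip ?d) = Inr False"
        using j Inr by (cases "node_slot (flip ?d)" rule: swap_slot.cases) (auto simp: node.joins_def)
      then have flip: "flip ?d = s" using s_unique[of "flip ?d"] in_nodes[OF mem(1)] by simp
      then have "fst ?d = fst (ys ! 0)" by (metis fst_flip nth_Cons_0 zs)
      then have "i = 0"
        using strand(1,2) i nth_eq_iff_index_eq[of "map fst ys" i 0] by auto
      then have "?d = s" using zs by simp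
      then show ?thesis using flip by simp
    qed
  qed
  then have "successively (\<lambda>a b. (a, b) \<in> parcs (three_arc_graph G)) p"
    by (simp add: p_def successively_conv_nth)
  ultimately have "vpath p (with_proj (three_arc_graph G))"
    using set strand(1) unfolding vpath_def vwalk_def
    by (auto simp: set_vwalk_arcs_subset_iff three_arc_graph_def p_def)
  then show ?thesis
    using hd last set by (auto simp: path_between_def three_arc_graph_def)
qed

end

theorem theorem3:
  fixes G :: "'a pair_pre_digraph"
  assumes "pair_graph G"
    and "edge_connected 2 G"
    and "min_degree G \<ge> 3"
    and "\<And>u v. \<lbrakk>u \<in> pverts G; v \<in> pverts G; u \<noteq> v\<rbrakk> \<Longrightarrow>
           \<exists>p. path_between G u p v \<and> odd (vwalk_length p)"
  shows "hamilton_connected (three_arc_graph G)"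
  unfolding hamilton_connected_def
proof (intro ballI impI)
  fix s t assume st: "s \<in> pverts (three_arc_graph G)" "t \<in> pverts (three_arc_graph G)" "s \<noteq> t"
  interpret pair_graph G by (rule assms(1))
  interpret bridgeless_graph G by unfold_locales (rule assms(2))
  define ep where "ep c = (if c then fst t else fst s)" for c :: bool
  define e where "e c = (if c then snd t else snd s)" for c :: bool
  have arcs: "(ep c, e c) \<in> parcs G" for c
    using st by (simp add: ep_def e_def three_arc_graph_def)
  have ne: "(ep False, e False) \<noteq> (ep True, e True)" using st(3) by (simp add: ep_def e_def)
  have V: "ep c \<in> pverts G" for c using arcs in_arcsD1 by blast
  have deg: "card (parcs G `` {w}) \<ge> 3" if "w \<in> pverts G" for w
  proof -
    have "min_degree G \<le> out_degree (with_proj G) w"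
      unfolding min_degree_def using that pair_finite_verts by (intro Min_le) auto
    moreover have "out_degree (with_proj G) w = card (parcs G `` {w})"
      unfolding out_degree_def out_arcs_def
      by (rule bij_betw_same_card[of snd]) (force simp: bij_betw_def inj_on_def)
    ultimately show ?thesis using assms(3) by simp
  qed
  obtain A B where AB: "alternating (ep False) (ep True) A B"
    "ep False \<noteq> ep True \<longrightarrow> (ep False, ep True) \<in> parcs G \<longrightarrow> ep True \<in> A (ep False)"
    by (rule alternating_exists[OF assms(4) V[of False] V[of True] arcs[of False]])
  obtain Z where Z: "harmless ep Z" "\<forall>w\<in>pverts G. \<exists>z. z \<in> parcs G `` {w} - Z w"
    "\<forall>w\<in>pverts G. \<exists>L. vertex_pattern e (parcs G `` {w}) (A w) (B w) {c. ep c = w} (main_slots ep Z w) L"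
    using harmless_patterns[OF deg arcs ne AB(1) AB(2)[rule_format]] by blast
  from Z(3) obtain L where "\<forall>w\<in>pverts G.
      vertex_pattern e (parcs G `` {w}) (A w) (B w) {c. ep c = w} (main_slots ep Z w) (L w)"
    by metis
  then interpret linked_graph G ep e A B Z L
    by unfold_locales (use arcs ne AB(1) Z in auto)
  show "\<exists>p. path_between (three_arc_graph G) s p t \<and> set p = pverts (three_arc_graph G)"
    using hamilton_path by (simp add: ep_def e_def)
qed

end
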